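(* Let $-A$ generate a positive compact $C_0$-semigroup $T(t)$ $(t\ge 0)$ on $E$ which is exponentially stable, i.e. $\nu_0<0$. Let $F:\mathbb{R}\times K\times K\to K$ be continuous and $\omega$-periodic in $t$. Assume: (H1) there are positive constants $C_1,C_2$ with $C_1+C_2\in(0,|\nu_0|)$ and a function $h_0\in C_\omega(\mathbb{R},K)$ such that $$F(t,x,y)\le C_1x+C_2y+h_0(t),\qquad t\in\mathbb{R},\ x,y\in K.$$ Then the delay evolution equation $u'(t)+Au(t)=F(t,u(t),u(t-\tau))$, $t\in\mathbb{R}$, has at least one positive $\omega$-periodic mild solution.
   Context: $E$ is a real Banach space ordered by a closed convex cone $K$ (the positive cone): $x\le y$ iff $y-x\in K$; $\theta$ denotes the zero vector. $K$ is normal: there is $N>0$ such that $\theta\le x\le y$ implies $\|x\|\le N\|y\|$. $A:D(A)\subset E\to E$ is a closed linear operator such that $-A$ generates a $C_0$-semigroup $T(t)$, $t\ge0$. The semigroup is positive if $T(t)K\subset K$ for all $t\ge0$, and compact if $T(t)$ is a compact operator for every $t>0$. Its growth exponent is $\nu_0=\inf\{\gamma\in\mathbb{R}: \exists M>0 \text{ with } \|T(t)\|\le Me^{\gamma t}\ \forall t\ge0\}$; the semigroup is exponentially stable if $\nu_0<0$. $\tau>0$ (the delay) and $\omega>0$ (the period) are fixed. $C_\omega(\mathbb{R},E)$ is the Banach space of continuous $\omega$-periodic functions $\mathbb{R}\to E$ with norm $\|u\|_C=\max_{t\in[0,\omega]}\|u(t)\|$, and $C_\omega(\mathbb{R},K)$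 is its subset of functions with values in $K$. A positive $\omega$-periodic mild solution of $u'(t)+Au(t)=F(t,u(t),u(t-\tau))$, $t\in\mathbb{R}$, is a function $u\in C_\omega(\mathbb{R},K)$ such that $u(t)=T(t-a)u(a)+\int_a^tT(t-s)F(s,u(s),u(s-\tau))\,ds$ for all $a\le t$; when $T$ is exponentially stable this is equivalent to $u(t)=(I-T(\omega))^{-1}\int_{t-\omega}^tT(t-s)F(s,u(s),u(s-\tau))\,ds$ for all $t\in\mathbb{R}$. *)

theory Defs
  imports "HOL-Analysis.Analysis"
begin

definition cone_le :: "'a::real_vector set \<Rightarrow> 'a \<Rightarrow> 'a \<Rightarrow> bool" where
  "cone_le K x y \<longleftrightarrow> y - x \<in> K"

definition closed_convex_cone :: "'a::real_normed_vector set \<Rightarrow> bool" where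
  "closed_convex_cone K \<longleftrightarrow> closed K \<and> convex K \<and> cone K \<and> K \<noteq> {}"

definition normal_cone :: "'a::real_normed_vector set \<Rightarrow> bool" where
  "normal_cone K \<longleftrightarrow> (\<exists>N>0. \<forall>x y. cone_le K 0 x \<and> cone_le K x y \<longrightarrow> norm x \<le> N * norm y)"

definition C0_semigroup :: "(real \<Rightarrow> 'a::banach \<Rightarrow>\<^sub>L 'a) \<Rightarrow> bool" where
  "C0_semigroup T \<longleftrightarrow> T 0 = id_blinfun
     \<and> (\<forall>t\<ge>0. \<forall>s\<ge>0. T (t + s) = T t o\<^sub>L T s)
     \<and> (\<forall>x. continuous_on {0..} (\<lambda>t. blinfun_apply (T t) x))"

definition is_generator :: "(real \<Rightarrow> 'a::banach \<Rightarrow>\<^sub>L 'a) \<Rightarrow> ('a \<Rightarrow> 'a) \<Rightarrow> 'a set \<Rightarrow> bool" where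
  "is_generator T G D \<longleftrightarrow>
     D = {x. \<exists>y. ((\<lambda>h. (1 / h) *\<^sub>R (blinfun_apply (T h) x - x)) \<longlongrightarrow> y) (at_right 0)}
     \<and> (\<forall>x\<in>D. ((\<lambda>h. (1 / h) *\<^sub>R (blinfun_apply (T h) x - x)) \<longlongrightarrow> G x) (at_right 0))"

definition closed_linear_operator :: "('a::real_normed_vector \<Rightarrow> 'a) \<Rightarrow> 'a set \<Rightarrow> bool" where
  "closed_linear_operator A D \<longleftrightarrow> subspace D
     \<and> (\<forall>x\<in>D. \<forall>y\<in>D. \<forall>c. A (x + c *\<^sub>R y) = A x + c *\<^sub>R A y)
     \<and> closed {(x, A x) | x. x \<in> D}"

definition positive_semigroup :: "(real \<Rightarrow> 'a::banach \<Rightarrow>\<^sub>L 'a) \<Rightarrow> 'a set \<Rightarrow> bool" where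
  "positive_semigroup T K \<longleftrightarrow> (\<forall>t\<ge>0. blinfun_apply (T t) ` K \<subseteq> K)"

definition compact_operator :: "('a::real_normed_vector \<Rightarrow>\<^sub>L 'b::real_normed_vector) \<Rightarrow> bool" where
  "compact_operator L \<longleftrightarrow> (\<forall>B. bounded B \<longrightarrow> compact (closure (blinfun_apply L ` B)))"

definition compact_semigroup :: "(real \<Rightarrow> 'a::banach \<Rightarrow>\<^sub>L 'a) \<Rightarrow> bool" where
  "compact_semigroup T \<longleftrightarrow> (\<forall>t>0. compact_operator (T t))"

text \<open>Growth exponent nu_0, as an extended real (may be -infinity).\<close>
definition growth_bound :: "(real \<Rightarrow> 'a::banach \<Rightarrow>\<^sub>L 'a) \<Rightarrow> ereal" where
  "growth_bound T = Inf {ereal \<gamma> | \<gamma>. \<exists>M>0. \<forall>t\<ge>0. norm (T t) \<le> M * exp (\<gamma> * t)}"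

definition positive_periodic_mild_solution ::
  "(real \<Rightarrow> 'a::banach \<Rightarrow>\<^sub>L 'a) \<Rightarrow> 'a set \<Rightarrow> (real \<Rightarrow> 'a \<Rightarrow> 'a \<Rightarrow> 'a) \<Rightarrow> real \<Rightarrow> real \<Rightarrow> (real \<Rightarrow> 'a) \<Rightarrow> bool" where
  "positive_periodic_mild_solution T K F \<tau> \<omega> u \<longleftrightarrow>
     continuous_on UNIV u \<and> (\<forall>t. u (t + \<omega>) = u t) \<and> (\<forall>t. u t \<in> K)
     \<and> (\<forall>a t. a \<le> t \<longrightarrow>
          ((\<lambda>s. blinfun_apply (T (t - s)) (F s (u s) (u (s - \<tau>))))
             has_integral (u t - blinfun_apply (T (t - a)) (u a))) {a..t})"

end

theory Submission
  imports Defs "HOL-Library.Real_Mod"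
begin

text \<open>
  Choose \<open>\<gamma>\<close> with \<open>C1 + C2 < \<gamma> < -\<nu>\<^sub>0\<close>. For bounded continuous \<open>f\<close> the equation \<open>u' + A u = f\<close> has
  the bounded mild solution \<open>S f t = \<integral> T (t - s) (f s) ds\<close>, integrated over \<open>s \<le> t\<close>; the operator \<open>S\<close> is
  positive and maps periodic functions to periodic functions. In the equivalent norm
  \<open>sup\<^sub>r exp (\<gamma> r) \<parallel>T r x\<parallel>\<close> it has norm at most \<open>1/\<gamma>\<close>, so a Neumann series gives a positive periodic
  solution \<open>v\<close> of the linear majorant \<open>v = S (C1 v + C2 v(\<cdot> - \<tau>) + h0)\<close>. By (H1),
  \<open>u \<mapsto> S (F(\<cdot>, u, u(\<cdot> - \<tau>)))\<close> maps the order interval \<open>{u. 0 \<le> u \<le> v}\<close> into itself; by normality of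
  the cone \<open>F\<close> is bounded along it, so compactness of the semigroup makes the image relatively compact,
  and Schauder's theorem gives a fixed point. Schauder's theorem is reduced to Kuhn's combinatorial lemma
  through Brouwer's theorem on cubes of arbitrary dimension.
\<close>

section \<open>The Brouwer and Schauder fixed point theorems\<close>

definition unit_cube :: "nat \<Rightarrow> (nat \<Rightarrow> real) set" where
  "unit_cube n = {x. (\<forall>i<n. 0 \<le> x i \<and> x i \<le> 1) \<and> (\<forall>i\<ge>n. x i = 0)}"

lemma compact_unit_cube: "compact (unit_cube n)"
proof -
  have "unit_cube n = PiE UNIV (\<lambda>i. if i < n then {0..1} else {0})"
    by (auto simp: unit_cube_def PiE_UNIV_domain Pi_iff split: if_splits)
  moreover have "compactin (product_topology (\<lambda>_. euclidean) UNIV)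
      (PiE UNIV (\<lambda>i::nat. if i < n then {0..1::real} else {0}))"
    unfolding compactin_PiE by auto
  ultimately show ?thesis
    by (metis compactin_euclidean_iff euclidean_product_topology)
qed

lemma continuous_on_coordinate: "continuous_on S (\<lambda>x :: 'a \<Rightarrow> 'b::topological_space. x i)"
  by (rule continuous_on_subset[OF continuous_on_product_coordinates subset_UNIV])

lemma tendsto_coordinatewise_iff:
  fixes X :: "'c \<Rightarrow> 'a \<Rightarrow> 'b::topological_space"
  shows "(X \<longlongrightarrow> x) F \<longleftrightarrow> (\<forall>i. ((\<lambda>n. X n i) \<longlongrightarrow> x i) F)"
proof -
  have "limitin (product_topology (\<lambda>_. euclidean) UNIV) X x F \<longleftrightarrow> (\<forall>i. limitin euclidean (\<lambda>n. X n i) (x i) F)"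
    by (subst limitin_componentwise) auto
  then show ?thesis
    by (simp add: euclidean_product_topology)
qed

definition grid_point :: "nat \<Rightarrow> nat \<Rightarrow> (nat \<Rightarrow> nat) \<Rightarrow> nat \<Rightarrow> real" where
  "grid_point n m y = (\<lambda>i. if i < n then real (y i) / real m else 0)"

lemma grid_point_in_unit_cube: "m > 0 \<Longrightarrow> \<forall>i<n. y i \<le> m \<Longrightarrow> grid_point n m y \<in> unit_cube n"
  by (auto simp: grid_point_def unit_cube_def)

lemma grid_points_of_cell_near:
  assumes "\<forall>i<n. q i \<le> y i \<and> y i \<le> q i + 1"
  shows "\<bar>grid_point n m y i - grid_point n m q i\<bar> \<le> 1 / real m"
proof (cases "i < n")
  case True
  with assms have "\<bar>real (y i) - real (q i)\<bar> \<le> 1" by force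
  then show ?thesis
    using True by (simp add: grid_point_def divide_right_mono flip: diff_divide_distrib)
qed (simp add: grid_point_def)

lemma poincare_miranda_unit_cube_approximate:
  fixes A B :: "nat \<Rightarrow> (nat \<Rightarrow> real) set"
  assumes cover: "\<And>i. i < n \<Longrightarrow> unit_cube n \<subseteq> A i \<union> B i"
    and lower_face: "\<And>i x. i < n \<Longrightarrow> x \<in> unit_cube n \<Longrightarrow> x i = 0 \<Longrightarrow> x \<in> A i"
    and upper_face: "\<And>i x. i < n \<Longrightarrow> x \<in> unit_cube n \<Longrightarrow> x i = 1 \<Longrightarrow> x \<in> B i"
    and "m > 0"
  obtains x where "x \<in> unit_cube n"
    "\<And>i. i < n \<Longrightarrow> \<exists>a\<in>A i. \<forall>j. \<bar>a j - x j\<bar> \<le> 1 / real m"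
    "\<And>i. i < n \<Longrightarrow> \<exists>b\<in>B i. \<forall>j. \<bar>b j - x j\<bar> \<le> 1 / real m"
proof -
  note grid_cube = grid_point_in_unit_cube[OF \<open>m > 0\<close>]
  define label where "label y i = (if grid_point n m y \<in> A i \<and> y i \<noteq> m then 0 else 1 :: nat)" for y i
  define in_cell where "in_cell q y \<longleftrightarrow> (\<forall>i<n. q i \<le> y i \<and> y i \<le> q i + 1)" for q y :: "nat \<Rightarrow> nat"
  obtain q where q: "\<forall>i<n. q i < m"
    and differ: "\<forall>i<n. \<exists>r s. in_cell q r \<and> in_cell q s \<and> label r i \<noteq> label s i"
  proof (rule kuhn_lemma[of m n label])
    show "\<forall>y. (\<forall>i<n. y i \<le> m) \<longrightarrow> (\<forall>i<n. y i = 0 \<longrightarrow> label y i = 0)"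
      using lower_face[OF _ grid_cube] \<open>m > 0\<close> by (auto simp: label_def grid_point_def)
  qed (use \<open>m > 0\<close> in \<open>auto simp: label_def in_cell_def\<close>)
  have in_A: "grid_point n m y \<in> A i" if "label y i = 0" for y i
    using that by (simp add: label_def split: if_splits)
  have in_B: "grid_point n m y \<in> B i" if "i < n" "in_cell q y" "label y i \<noteq> 0" for y i
  proof -
    have cube: "grid_point n m y \<in> unit_cube n"
    proof (intro grid_cube allI impI)
      fix j assume "j < n"
      then show "y j \<le> m"
        using q that(2) unfolding in_cell_def by (metis Suc_eq_plus1 Suc_leI le_trans)
    qed
    have "grid_point n m y \<in> B i" if "y i = m"
      using upper_face[OF \<open>i < n\<close> cube] that \<open>i < n\<close> \<open>m > 0\<close> by (simp add: grid_point_def)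
    then show ?thesis
      using cover[OF \<open>i < n\<close>] cube \<open>label y i \<noteq> 0\<close> by (auto simp: label_def split: if_splits)
  qed
  show ?thesis
  proof (rule that[of "grid_point n m q"])
    show "grid_point n m q \<in> unit_cube n" using q by (intro grid_cube) auto
    fix i assume "i < n"
    then obtain r s where "in_cell q r" "in_cell q s" "label r i \<noteq> label s i"
      using differ by blast
    moreover have "label y i = 0 \<or> label y i = 1" for y
      by (simp add: label_def)
    ultimately obtain r s where "in_cell q r" "label r i = 0" "in_cell q s" "label s i \<noteq> 0"
      by (metis zero_neq_one)
    then show "\<exists>a\<in>A i. \<forall>j. \<bar>a j - grid_point n m q j\<bar> \<le> 1 / real m"
      and "\<exists>b\<in>B i. \<forall>j. \<bar>b j - grid_point n m q j\<bar> \<le> 1 / real m"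
      using in_A[of r i] in_B[OF \<open>i < n\<close>, of s] grid_points_of_cell_near unfolding in_cell_def by blast+
  qed
qed

lemma limit_in_closed_if_coordinates_near:
  fixes X :: "nat \<Rightarrow> 'a \<Rightarrow> real"
  assumes "X \<longlonglongrightarrow> z" "closed S" "\<delta> \<longlonglongrightarrow> 0" and near: "\<And>m. \<exists>y\<in>S. \<forall>j. \<bar>y j - X m j\<bar> \<le> \<delta> m"
  shows "z \<in> S"
proof -
  obtain Y where Y: "\<And>m. Y m \<in> S" "\<And>m j. \<bar>Y m j - X m j\<bar> \<le> \<delta> m"
    using near by metis
  have "(\<lambda>m. Y m j) \<longlonglongrightarrow> z j" for j
  proof -
    have "(\<lambda>m. Y m j - X m j) \<longlonglongrightarrow> 0"
      by (rule Lim_null_comparison[OF _ \<open>\<delta> \<longlonglongrightarrow> 0\<close>]) (use Y(2) in auto)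
    moreover have "(\<lambda>m. X m j) \<longlonglongrightarrow> z j"
      using \<open>X \<longlonglongrightarrow> z\<close> by (simp add: tendsto_coordinatewise_iff)
    ultimately show ?thesis
      using tendsto_add by fastforce
  qed
  then have "Y \<longlonglongrightarrow> z"
    by (simp add: tendsto_coordinatewise_iff)
  then show ?thesis
    by (rule closed_sequentially[OF \<open>closed S\<close> Y(1)])
qed

lemma poincare_miranda_unit_cube:
  fixes A B :: "nat \<Rightarrow> (nat \<Rightarrow> real) set"
  assumes closed: "\<And>i. i < n \<Longrightarrow> closed (A i)" "\<And>i. i < n \<Longrightarrow> closed (B i)"
    and cover: "\<And>i. i < n \<Longrightarrow> unit_cube n \<subseteq> A i \<union> B i"
    and lower_face: "\<And>i x. i < n \<Longrightarrow> x \<in> unit_cube n \<Longrightarrow> x i = 0 \<Longrightarrow> x \<in> A i"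
    and upper_face: "\<And>i x. i < n \<Longrightarrow> x \<in> unit_cube n \<Longrightarrow> x i = 1 \<Longrightarrow> x \<in> B i"
  obtains x where "x \<in> unit_cube n" "\<And>i. i < n \<Longrightarrow> x \<in> A i \<inter> B i"
proof -
  define \<delta> where "\<delta> m = 1 / real (Suc m)" for m
  have "\<exists>x\<in>unit_cube n. \<forall>i<n. (\<exists>a\<in>A i. \<forall>j. \<bar>a j - x j\<bar> \<le> \<delta> m) \<and> (\<exists>b\<in>B i. \<forall>j. \<bar>b j - x j\<bar> \<le> \<delta> m)" for m
  proof -
    obtain x where "x \<in> unit_cube n" "\<And>i. i < n \<Longrightarrow> \<exists>a\<in>A i. \<forall>j. \<bar>a j - x j\<bar> \<le> \<delta> m"
      "\<And>i. i < n \<Longrightarrow> \<exists>b\<in>B i. \<forall>j. \<bar>b j - x j\<bar> \<le> \<delta> m"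
      unfolding \<delta>_def
      by (rule poincare_miranda_unit_cube_approximate[of n A B "Suc m", OF _ _ _ zero_less_Suc])
        (use cover lower_face upper_face in blast)+
    then show ?thesis by blast
  qed
  then obtain X where X: "\<And>m. X m \<in> unit_cube n"
    and near_A: "\<And>m i. i < n \<Longrightarrow> \<exists>a\<in>A i. \<forall>j. \<bar>a j - X m j\<bar> \<le> \<delta> m"
    and near_B: "\<And>m i. i < n \<Longrightarrow> \<exists>b\<in>B i. \<forall>j. \<bar>b j - X m j\<bar> \<le> \<delta> m"
    by metis
  obtain z k where z: "z \<in> unit_cube n" and k: "strict_mono k" and lim: "(X \<circ> k) \<longlonglongrightarrow> z"
    using compact_imp_seq_compact[OF compact_unit_cube[of n]] X by (metis seq_compactE)
  have "(\<delta> \<circ> k) \<longlonglongrightarrow> 0"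
    using LIMSEQ_subseq_LIMSEQ[OF LIMSEQ_inverse_real_of_nat k] by (simp add: \<delta>_def o_def inverse_eq_divide)
  then have "z \<in> A i \<inter> B i" if "i < n" for i
    using limit_in_closed_if_coordinates_near[OF lim closed(1)[OF that]] near_A[OF that]
      limit_in_closed_if_coordinates_near[OF lim closed(2)[OF that]] near_B[OF that]
    by simp
  with z that show ?thesis by blast
qed

lemma brouwer_unit_cube:
  assumes cont: "continuous_on (unit_cube n) f" and maps: "f \<in> unit_cube n \<rightarrow> unit_cube n"
  obtains x where "x \<in> unit_cube n" "f x = x"
proof -
  define A where "A i = {x \<in> unit_cube n. x i \<le> f x i}" for i
  define B where "B i = {x \<in> unit_cube n. f x i \<le> x i}" for i
  have f_cube: "f x \<in> unit_cube n" if "x \<in> unit_cube n" for x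
    using that maps by blast
  have closed: "closed (A i)" "closed (B i)" for i
    unfolding A_def B_def
    by (intro continuous_on_closed_Collect_le continuous_on_coordinate
        continuous_on_product_then_coordinatewise[OF cont] compact_imp_closed[OF compact_unit_cube])+
  obtain x where x: "x \<in> unit_cube n" and between: "\<And>i. i < n \<Longrightarrow> x \<in> A i \<inter> B i"
  proof (rule poincare_miranda_unit_cube[of n A B])
    show "x \<in> A i" if "i < n" "x \<in> unit_cube n" "x i = 0" for i x
      using f_cube[of x] that by (auto simp: A_def unit_cube_def)
    show "x \<in> B i" if "i < n" "x \<in> unit_cube n" "x i = 1" for i x
      using f_cube[of x] that by (auto simp: B_def unit_cube_def)
    show "unit_cube n \<subseteq> A i \<union> B i" for i
      by (auto simp: A_def B_def)
  qed (use closed in auto)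
  have "f x i = x i" for i
  proof (cases "i < n")
    case True
    with between show ?thesis by (force simp: A_def B_def)
  next
    case False
    with x f_cube[OF x] show ?thesis by (simp add: unit_cube_def)
  qed
  with x that show ?thesis by blast
qed

lemma unit_cube_map_to_convex:
  fixes C :: "'a::real_normed_vector set" and y :: "nat \<Rightarrow> 'a"
  assumes C: "convex C" "C \<noteq> {}" and y: "\<And>i. i < n \<Longrightarrow> y i \<in> C"
  obtains p where "continuous_on (unit_cube n) p" "p \<in> unit_cube n \<rightarrow> C"
    "\<And>l. l \<in> unit_cube n \<Longrightarrow> (\<Sum>i<n. l i) = 1 \<Longrightarrow> p l = (\<Sum>i<n. l i *\<^sub>R y i)"
proof -
  obtain x0 where "x0 \<in> C" using C(2) by blast
  \<comment> \<open>\<open>coeff\<close> retracts the cube onto \<open>{l \<ge> 0, \<Sum>l \<le> 1}\<close>; the missing mass goes to \<open>x0\<close>.\<close>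
  define coeff where "coeff l i = l i / max 1 (\<Sum>j<n. l j)" for l :: "nat \<Rightarrow> real" and i
  define p where "p l = (\<Sum>i<n. coeff l i *\<^sub>R y i) + (1 - (\<Sum>i<n. coeff l i)) *\<^sub>R x0" for l
  have "continuous_on (unit_cube n) (\<lambda>l. coeff l i)" for i
    unfolding coeff_def
    by (intro continuous_on_divide continuous_on_max continuous_on_sum continuous_on_const
        continuous_on_coordinate ballI) linarith
  then have "continuous_on (unit_cube n) p"
    unfolding p_def[abs_def] by (intro continuous_intros)
  moreover have "p l \<in> C" if "l \<in> unit_cube n" for l
  proof -
    have coeff_sum: "(\<Sum>i<n. coeff l i) \<le> 1"
      by (simp add: coeff_def divide_le_eq flip: sum_divide_distrib)
    have "p l = (\<Sum>i\<le>n. (if i < n then coeff l i else 1 - (\<Sum>i<n. coeff l i)) *\<^sub>R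
        (if i < n then y i else x0))"
      by (simp add: p_def flip: lessThan_Suc_atMost)
    also have "\<dots> \<in> C"
      using coeff_sum that y \<open>x0 \<in> C\<close>
      by (intro convex_sum C) (auto simp: unit_cube_def coeff_def simp flip: lessThan_Suc_atMost)
    finally show ?thesis .
  qed
  moreover have "p l = (\<Sum>i<n. l i *\<^sub>R y i)" if "(\<Sum>i<n. l i) = 1" for l
    using that by (simp add: p_def coeff_def)
  ultimately show ?thesis using that by blast
qed

lemma fixpoint_weighted_sum:
  fixes C :: "'a::real_normed_vector set" and y :: "nat \<Rightarrow> 'a" and w :: "nat \<Rightarrow> 'a \<Rightarrow> real"
  assumes C: "convex C" "C \<noteq> {}" and y: "\<And>i. i < n \<Longrightarrow> y i \<in> C"
    and w_cont: "\<And>i. i < n \<Longrightarrow> continuous_on C (w i)"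
    and w_nonneg: "\<And>i x. i < n \<Longrightarrow> x \<in> C \<Longrightarrow> w i x \<ge> 0"
    and w_sum: "\<And>x. x \<in> C \<Longrightarrow> (\<Sum>i<n. w i x) = 1"
  obtains x where "x \<in> C" "x = (\<Sum>i<n. w i x *\<^sub>R y i)"
proof -
  obtain p where p: "continuous_on (unit_cube n) p" "p \<in> unit_cube n \<rightarrow> C"
    and p_eq: "\<And>l. l \<in> unit_cube n \<Longrightarrow> (\<Sum>i<n. l i) = 1 \<Longrightarrow> p l = (\<Sum>i<n. l i *\<^sub>R y i)"
    using unit_cube_map_to_convex[where y = y, OF C y] by blast
  define weights where "weights l i = (if i < n then w i (p l) else 0)" for l i
  have "continuous_on (unit_cube n) (\<lambda>l. weights l i)" for i
    using continuous_on_compose2[OF w_cont p(1), of i] p(2)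
    by (cases "i < n") (auto simp: weights_def)
  then have "continuous_on (unit_cube n) weights"
    by (rule continuous_on_coordinatewise_then_product)
  moreover have "weights \<in> unit_cube n \<rightarrow> unit_cube n"
  proof
    fix l assume "l \<in> unit_cube n"
    with p(2) have "p l \<in> C" by blast
    have "w i (p l) \<le> 1" if "i < n" for i
      unfolding w_sum[OF \<open>p l \<in> C\<close>, symmetric]
      using that w_nonneg \<open>p l \<in> C\<close> by (intro member_le_sum) auto
    then show "weights l \<in> unit_cube n"
      using w_nonneg \<open>p l \<in> C\<close> by (simp add: unit_cube_def weights_def)
  qed
  ultimately obtain l where l: "l \<in> unit_cube n" "weights l = l"
    by (rule brouwer_unit_cube)
  have "p l \<in> C" using l(1) p(2) by blast
  have l_eq: "l i = w i (p l)" if "i < n" for i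
    using fun_cong[OF l(2), of i] that by (simp add: weights_def)
  then have "(\<Sum>i<n. l i) = 1"
    using w_sum[OF \<open>p l \<in> C\<close>] by simp
  then have "p l = (\<Sum>i<n. w i (p l) *\<^sub>R y i)"
    using p_eq[OF l(1)] l_eq by simp
  with \<open>p l \<in> C\<close> that show ?thesis by blast
qed

lemma convex_combination_near:
  fixes z :: "'a::real_normed_vector"
  assumes nonneg: "\<And>i. i \<in> I \<Longrightarrow> w i \<ge> 0" and sum: "sum w I = 1"
    and near: "\<And>i. i \<in> I \<Longrightarrow> w i \<noteq> 0 \<Longrightarrow> norm (z - y i) \<le> e"
  shows "norm (z - (\<Sum>i\<in>I. w i *\<^sub>R y i)) \<le> e"
proof -
  have "z - (\<Sum>i\<in>I. w i *\<^sub>R y i) = (\<Sum>i\<in>I. w i *\<^sub>R (z - y i))"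
    using sum by (simp add: scaleR_diff_right sum_subtractf flip: scaleR_sum_left)
  also have "norm \<dots> \<le> (\<Sum>i\<in>I. w i * e)"
  proof (rule sum_norm_le)
    fix i assume "i \<in> I"
    with nonneg near show "norm (w i *\<^sub>R (z - y i)) \<le> w i * e"
      by (cases "w i = 0") (auto intro: mult_left_mono)
  qed
  also have "\<dots> = e"
    using sum by (simp flip: sum_distrib_right)
  finally show ?thesis .
qed

lemma finite_net_of_compact_closure:
  fixes S :: "'a::metric_space set"
  assumes "compact (closure S)" "e > 0"
  obtains Y where "finite Y" "Y \<subseteq> S" "S \<subseteq> (\<Union>y\<in>Y. ball y e)"
proof -
  have "closure S \<subseteq> (\<Union>y\<in>S. ball y e)"
    using assms(2) by (force simp: closure_approachable)
  then show ?thesis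
    using compactE_image[OF assms(1), of S "\<lambda>y. ball y e"] closure_subset that
    by (metis open_ball order_trans)
qed

lemma schauder_approximate_fixpoint:
  fixes f :: "'a::real_normed_vector \<Rightarrow> 'a"
  assumes C: "convex C" "C \<noteq> {}" and cont: "continuous_on C f" and maps: "f \<in> C \<rightarrow> C"
    and cpt: "compact (closure (f ` C))" and e: "e > 0"
  obtains x where "x \<in> C" "norm (f x - x) \<le> e"
proof -
  obtain Y where Y: "finite Y" "Y \<subseteq> f ` C" "f ` C \<subseteq> (\<Union>y\<in>Y. ball y e)"
    using finite_net_of_compact_closure[OF cpt e] .
  then obtain y and n :: nat where y: "Y = y ` {i. i < n}"
    by (metis finite_imp_nat_seg_image_inj_on)
  define hat where "hat i x = max 0 (e - norm (f x - y i))" for i x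
  define w where "w i x = hat i x / (\<Sum>j<n. hat j x)" for i x
  have hat_sum_pos: "(\<Sum>j<n. hat j x) > 0" if x: "x \<in> C" for x
  proof -
    obtain i where "i < n" "f x \<in> ball (y i) e"
      using Y(3) y x by blast
    then show ?thesis
      by (intro sum_pos2[of _ i]) (auto simp: hat_def dist_norm norm_minus_commute)
  qed
  have hat_cont: "continuous_on C (hat i)" for i
    unfolding hat_def by (intro continuous_intros cont)
  have w_nonneg: "w i x \<ge> 0" for i x
    by (auto simp: w_def hat_def intro!: divide_nonneg_nonneg sum_nonneg)
  have w_sum: "(\<Sum>i<n. w i x) = 1" if "x \<in> C" for x
    using hat_sum_pos[OF that] by (simp add: w_def flip: sum_divide_distrib)
  obtain x where x: "x \<in> C" "x = (\<Sum>i<n. w i x *\<^sub>R y i)"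
  proof (rule fixpoint_weighted_sum[OF C, of n y w])
    show "y i \<in> C" if "i < n" for i
      using that Y(2) maps unfolding y image_subset_iff by (auto simp: Pi_iff)
    show "continuous_on C (w i)" for i
      unfolding w_def[abs_def] using hat_sum_pos
      by (intro continuous_on_divide continuous_on_sum hat_cont) force
  qed (use w_nonneg w_sum in auto)
  have "norm (f x - (\<Sum>i<n. w i x *\<^sub>R y i)) \<le> e"
    using w_nonneg w_sum[OF x(1)] by (rule convex_combination_near) (auto simp: w_def hat_def)
  with x that show ?thesis by metis
qed

theorem schauder_fixpoint:
  fixes f :: "'a::real_normed_vector \<Rightarrow> 'a"
  assumes C: "convex C" "closed C" "C \<noteq> {}" and cont: "continuous_on C f" and maps: "f \<in> C \<rightarrow> C"
    and cpt: "compact (closure (f ` C))"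
  obtains x where "x \<in> C" "f x = x"
proof -
  have "\<exists>x\<in>C. norm (f x - x) \<le> inverse (real (Suc n))" for n
    using schauder_approximate_fixpoint[OF C(1,3) cont maps cpt, of "inverse (real (Suc n))"] by auto
  then obtain x where x: "\<And>n. x n \<in> C" and near: "\<And>n. norm (f (x n) - x n) \<le> inverse (real (Suc n))"
    by metis
  have "\<forall>n. f (x n) \<in> closure (f ` C)"
    using x closure_subset by blast
  then obtain z k where z: "z \<in> closure (f ` C)" and k: "strict_mono k" and lim: "((\<lambda>n. f (x n)) \<circ> k) \<longlonglongrightarrow> z"
    using compact_imp_seq_compact[OF cpt] by (metis seq_compactE)
  have "closure (f ` C) \<subseteq> C"
    using maps C(2) by (intro closure_minimal) auto
  with z have "z \<in> C" by blast
  have "(\<lambda>n. f (x n) - x n) \<longlonglongrightarrow> 0"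
    using near by (intro Lim_null_comparison[OF _ LIMSEQ_inverse_real_of_nat]) auto
  then have "(\<lambda>n. f (x (k n)) - x (k n)) \<longlonglongrightarrow> 0"
    using LIMSEQ_subseq_LIMSEQ[OF _ k] by (fastforce simp: o_def)
  from tendsto_diff[OF lim[unfolded o_def] this] have xk: "(\<lambda>n. x (k n)) \<longlonglongrightarrow> z"
    by simp
  then have "(\<lambda>n. f (x (k n))) \<longlonglongrightarrow> f z"
    using continuous_on_tendsto_compose[OF cont xk \<open>z \<in> C\<close>] x by simp
  then have "f z = z"
    using lim LIMSEQ_unique by (auto simp: o_def)
  with \<open>z \<in> C\<close> that show ?thesis by blast
qed

section \<open>Cones in Banach spaces\<close>

lemma closed_convex_coneD:
  assumes "closed_convex_cone K"
  shows "closed K" "convex K" "0 \<in> K" "\<And>x y. x \<in> K \<Longrightarrow> y \<in> K \<Longrightarrow> x + y \<in> K"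
    "\<And>x c. x \<in> K \<Longrightarrow> c \<ge> 0 \<Longrightarrow> c *\<^sub>R x \<in> K"
  using assms convex_cone[of K] cone_contains_0[of K] by (auto simp: closed_convex_cone_def cone_def)

lemma closed_convex_coneI:
  assumes "closed K" "0 \<in> K" "\<And>x y. x \<in> K \<Longrightarrow> y \<in> K \<Longrightarrow> x + y \<in> K"
    "\<And>x c. x \<in> K \<Longrightarrow> c \<ge> 0 \<Longrightarrow> c *\<^sub>R x \<in> K"
  shows "closed_convex_cone K"
proof -
  have "convex K \<and> cone K"
    unfolding convex_cone using assms(3,4) by blast
  then show ?thesis
    using assms(1,2) unfolding closed_convex_cone_def by blast
qed

lemma sum_in_closed_convex_cone:
  assumes "closed_convex_cone K" "\<And>i. i \<in> I \<Longrightarrow> f i \<in> K"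
  shows "sum f I \<in> K"
  using assms(2) by (induction I rule: infinite_finite_induct) (auto simp: closed_convex_coneD[OF assms(1)])

lemma suminf_in_closed_convex_cone:
  fixes f :: "nat \<Rightarrow> 'a::real_normed_vector"
  assumes K: "closed_convex_cone K" and "summable f" and fK: "\<And>n. f n \<in> K"
  shows "suminf f \<in> K"
proof (rule closed_sequentially[OF closed_convex_coneD(1)[OF K]])
  show "(\<lambda>n. \<Sum>i<n. f i) \<longlonglongrightarrow> suminf f"
    using \<open>summable f\<close> by (rule summable_LIMSEQ)
  show "(\<Sum>i<n. f i) \<in> K" for n
    using K fK by (rule sum_in_closed_convex_cone)
qed

lemma has_integral_in_closed_convex_cone:
  fixes f :: "real \<Rightarrow> 'a::banach"
  assumes K: "closed_convex_cone K" and f: "(f has_integral y) {a..b}" and fK: "\<And>x. x \<in> {a..b} \<Longrightarrow> f x \<in> K"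
  shows "y \<in> K"
proof -
  have "\<exists>z\<in>K. dist z y < e" if "e > 0" for e
  proof -
    obtain g where g: "gauge g" "\<forall>D. D tagged_division_of {a..b} \<and> g fine D \<longrightarrow>
        norm ((\<Sum>(x,k)\<in>D. measure lborel k *\<^sub>R f x) - y) < e"
      using has_integral_real[THEN iffD1, rule_format, OF f \<open>e > 0\<close>] by (elim exE conjE)
    obtain D where D: "D tagged_division_of {a..b}" "g fine D"
      using fine_division_exists_real[OF g(1)] by blast
    have "(\<Sum>(x,k)\<in>D. measure lborel k *\<^sub>R f x) \<in> K"
    proof (rule sum_in_closed_convex_cone[OF K], clarify)
      fix x k assume "(x, k) \<in> D"
      then have "f x \<in> K"
        using tagged_division_ofD(2,3)[OF D(1)] fK by blast
      then show "measure lborel k *\<^sub>R f x \<in> K"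
        by (simp add: closed_convex_coneD[OF K])
    qed
    with g(2) D show ?thesis
      unfolding dist_norm by blast
  qed
  then show ?thesis
    using closed_approachable[OF closed_convex_coneD(1)[OF K]] by blast
qed

definition cone_interval :: "'a::real_vector set \<Rightarrow> 'a \<Rightarrow> 'a \<Rightarrow> 'a set" where
  "cone_interval K a b = {x. cone_le K a x \<and> cone_le K x b}"

lemma cone_interval_eq: "cone_interval K a b = (\<lambda>x. x - a) -` K \<inter> (\<lambda>x. b - x) -` K"
  by (auto simp: cone_interval_def cone_le_def)

lemma closed_cone_interval:
  fixes a b :: "'a::real_normed_vector"
  assumes "closed K"
  shows "closed (cone_interval K a b)"
  unfolding cone_interval_eq
  by (intro closed_Int closed_vimage[OF assms] continuous_intros)

lemma convex_cone_interval:
  assumes "convex K"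
  shows "convex (cone_interval K a b)"
proof (rule convexI)
  fix x y and s t :: real
  assume xy: "x \<in> cone_interval K a b" "y \<in> cone_interval K a b" and st: "0 \<le> s" "0 \<le> t" "s + t = 1"
  have a_b: "a = s *\<^sub>R a + t *\<^sub>R a" "b = s *\<^sub>R b + t *\<^sub>R b"
    by (simp_all add: st(3) flip: scaleR_left_distrib)
  have "s *\<^sub>R (x - a) + t *\<^sub>R (y - a) \<in> K" "s *\<^sub>R (b - x) + t *\<^sub>R (b - y) \<in> K"
    using xy st by (auto simp: cone_interval_eq intro!: convexD[OF assms])
  moreover have "s *\<^sub>R (x - a) + t *\<^sub>R (y - a) = s *\<^sub>R x + t *\<^sub>R y - a"
    by (subst (3) a_b(1)) (simp add: algebra_simps)
  moreover have "s *\<^sub>R (b - x) + t *\<^sub>R (b - y) = b - (s *\<^sub>R x + t *\<^sub>R y)"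
    by (subst (3) a_b(2)) (simp add: algebra_simps)
  ultimately show "s *\<^sub>R x + t *\<^sub>R y \<in> cone_interval K a b"
    by (simp add: cone_interval_eq)
qed

lemma bounded_cone_interval:
  assumes "normal_cone K"
  shows "bounded (cone_interval K 0 b)"
  using assms by (auto simp: normal_cone_def bounded_iff cone_interval_def)

section \<open>Spaces of bounded continuous functions\<close>

lemma continuous_on_Pair_if_lipschitz:
  fixes f :: "'a::metric_space \<Rightarrow> 'b::metric_space \<Rightarrow> 'c::metric_space"
  assumes "\<And>t. t \<in> S \<Longrightarrow> L-lipschitz_on X (f t)" and "\<And>x. x \<in> X \<Longrightarrow> continuous_on S (\<lambda>t. f t x)"
  shows "continuous_on (S \<times> X) (\<lambda>(t, x). f t x)"
proof (rule continuous_on_TimesI[OF local_lipschitzI assms(2)])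
  show "\<exists>u>0. \<exists>L. \<forall>s\<in>cball t u \<inter> S. L-lipschitz_on (cball x u \<inter> X) (f s)" for t x
    using assms(1) lipschitz_on_subset by (intro exI[of _ 1]) (auto, blast)
qed

lemma continuous_on_apply_bcontfun_Pair [continuous_intros]:
  fixes u :: "'c::topological_space \<Rightarrow> 'a::metric_space \<Rightarrow>\<^sub>C 'b::metric_space"
  assumes "continuous_on S u" "continuous_on S t"
  shows "continuous_on S (\<lambda>x. u x (t x))"
proof -
  have "continuous_on (UNIV \<times> UNIV) (\<lambda>(t, u :: 'a \<Rightarrow>\<^sub>C 'b). u t)"
    by (rule continuous_on_Pair_if_lipschitz[where L = 1]) (auto intro!: lipschitz_onI dist_bounded)
  from continuous_on_compose2[OF this continuous_on_Pair[OF assms(2,1)]] show ?thesis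
    by simp
qed

instance bcontfun :: (metric_space, banach) banach ..

lemma compact_closure_subset:
  assumes "S \<subseteq> S'" "compact (closure S')"
  shows "compact (closure S)"
  using compact_Int_closed[OF assms(2) closed_closure[of S]] closure_mono[OF assms(1)]
  by (simp add: Int_absorb1)

lemma compact_closure_if_near_compact:
  fixes S :: "'a::complete_space set"
  assumes near: "\<And>e. e > 0 \<Longrightarrow> \<exists>C. compact C \<and> (\<forall>x\<in>S. \<exists>y\<in>C. dist x y < e)"
  shows "compact (closure S)"
  unfolding compact_eq_totally_bounded
proof (intro conjI allI impI)
  show "complete (closure S)" by (simp add: complete_eq_closed)
  fix e :: real assume "e > 0"
  then obtain C where C: "compact C" "\<forall>x\<in>S. \<exists>y\<in>C. dist x y < e / 3"
    using near[of "e / 3"] by auto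
  then obtain Y where Y: "finite Y" "C \<subseteq> (\<Union>y\<in>Y. ball y (e / 3))"
    using \<open>e > 0\<close> unfolding compact_eq_totally_bounded by (meson divide_pos_pos zero_less_numeral)
  have "closure S \<subseteq> (\<Union>y\<in>Y. ball y e)"
  proof
    fix x assume "x \<in> closure S"
    then obtain x' where x': "x' \<in> S" "dist x' x < e / 3"
      using \<open>e > 0\<close> by (meson closure_approachable divide_pos_pos zero_less_numeral)
    then obtain c where c: "c \<in> C" "dist x' c < e / 3" using C(2) by blast
    then obtain y where y: "y \<in> Y" "dist y c < e / 3" using Y(2) by auto
    have "dist y x < e"
      using x'(2) c(2) y(2) dist_triangle[of y x c] dist_triangle[of c x x'] by (simp add: dist_commute)
    with y(1) show "x \<in> (\<Union>y\<in>Y. ball y e)" by auto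
  qed
  with Y(1) show "\<exists>Y. finite Y \<and> closure S \<subseteq> (\<Union>y\<in>Y. ball y e)" by blast
qed

lemma finite_net_of_pointwise_compact_closure:
  fixes \<F> :: "('a \<Rightarrow> 'b::metric_space) set"
  assumes "finite G" and pointwise: "\<And>g. g \<in> G \<Longrightarrow> compact (closure ((\<lambda>f. f g) ` \<F>))" and "e > 0"
  obtains \<W> where "finite \<W>" "\<W> \<subseteq> \<F>" "\<And>f. f \<in> \<F> \<Longrightarrow> \<exists>w\<in>\<W>. \<forall>g\<in>G. dist (f g) (w g) < e"
proof -
  have "\<exists>Y. g \<in> G \<longrightarrow> finite Y \<and> (\<forall>f\<in>\<F>. \<exists>y\<in>Y. dist y (f g) < e / 2)" for g
  proof (cases "g \<in> G")
    case True
    obtain Y where "finite Y" "(\<lambda>f. f g) ` \<F> \<subseteq> (\<Union>y\<in>Y. ball y (e / 2))"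
      using finite_net_of_compact_closure[OF pointwise[OF True] half_gt_zero[OF \<open>e > 0\<close>]] .
    then show ?thesis by (intro exI[of _ Y]) (auto simp: subset_iff)
  qed simp
  then obtain Y where Y: "\<And>g. g \<in> G \<Longrightarrow> finite (Y g)"
    and net: "\<And>f g. f \<in> \<F> \<Longrightarrow> g \<in> G \<Longrightarrow> \<exists>y\<in>Y g. dist y (f g) < e / 2"
    by metis
  from net obtain center where center: "\<And>f g. f \<in> \<F> \<Longrightarrow> g \<in> G \<Longrightarrow> center f g \<in> Y g"
      "\<And>f g. f \<in> \<F> \<Longrightarrow> g \<in> G \<Longrightarrow> dist (center f g) (f g) < e / 2"
    by metis
  define code where "code f = restrict (center f) G" for f
  have "code ` \<F> \<subseteq> PiE G Y"
    using center(1) by (auto simp: code_def)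
  then have "finite (code ` \<F>)"
    by (rule finite_subset) (intro finite_PiE \<open>finite G\<close> Y)
  moreover have "inv_into \<F> code ` code ` \<F> \<subseteq> \<F>"
    by (auto intro: inv_into_into)
  moreover have "dist (f g) (inv_into \<F> code (code f) g) < e" if f: "f \<in> \<F>" and g: "g \<in> G" for f g
  proof -
    define w where "w = inv_into \<F> code (code f)"
    have w: "w \<in> \<F>" "code w = code f"
      unfolding w_def using imageI[OF f, of code] by (simp_all only: inv_into_into f_inv_into_f)
    have "center w g = center f g"
      using fun_cong[OF w(2), of g] g by (simp add: code_def)
    then show ?thesis
      using dist_triangle_half_r[OF center(2)[OF f g]] center(2)[OF w(1) g]
      unfolding w_def[symmetric] by simp
  qed
  ultimately show ?thesis
    using that[of "inv_into \<F> code ` code ` \<F>"] by blast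
qed

lemma compact_closure_bcontfun:
  fixes \<F> :: "('a::metric_space \<Rightarrow>\<^sub>C 'b::complete_space) set"
  assumes pointwise: "\<And>t. compact (closure ((\<lambda>u. apply_bcontfun u t) ` \<F>))"
    and oscillation: "\<And>e. e > 0 \<Longrightarrow> \<exists>G. finite G \<and>
      (\<forall>t. \<exists>g\<in>G. \<forall>u\<in>\<F>. dist (u t) (u g) < e)"
  shows "compact (closure \<F>)"
proof (rule compact_closure_if_near_compact)
  fix e :: real assume "e > 0"
  then have "e / 4 > 0" by simp
  from oscillation[OF this] obtain G where G: "finite G"
    "\<forall>t. \<exists>g\<in>G. \<forall>u\<in>\<F>. dist (u t) (u g) < e / 4"
    by (elim exE conjE)
  have "compact (closure ((\<lambda>f. f g) ` apply_bcontfun ` \<F>))" for g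
    using pointwise by (simp add: image_image)
  then obtain \<W> where "finite \<W>" "\<W> \<subseteq> apply_bcontfun ` \<F>"
    and near_on_G: "\<And>f. f \<in> apply_bcontfun ` \<F> \<Longrightarrow> \<exists>w\<in>\<W>. \<forall>g\<in>G. dist (f g) (w g) < e / 4"
    using finite_net_of_pointwise_compact_closure[OF G(1) _ \<open>e / 4 > 0\<close>, of "apply_bcontfun ` \<F>"] by metis
  then obtain W where W: "finite W" "W \<subseteq> \<F>" "\<W> = apply_bcontfun ` W"
    using finite_subset_image by metis
  have "\<exists>w\<in>W. dist u w < e" if u: "u \<in> \<F>" for u
  proof -
    obtain w where w: "w \<in> W" "\<forall>g\<in>G. dist (u g) (w g) < e / 4"
      using near_on_G[OF imageI[OF u]] W(3) by auto
    have "dist (u t) (w t) \<le> 3 * (e / 4)" for t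
    proof -
      obtain g where g: "g \<in> G" "\<And>u. u \<in> \<F> \<Longrightarrow> dist (u t) (u g) < e / 4"
        using G(2) by metis
      show ?thesis
        using g(2)[OF u] g(2)[OF subsetD[OF W(2) w(1)]] bspec[OF w(2) g(1)]
          dist_triangle[of "u t" "w t" "u g"]
          dist_triangle[of "u g" "w t" "w g"]
        by (simp add: dist_commute)
    qed
    then have "dist u w \<le> 3 * (e / 4)" by (rule dist_bound)
    with \<open>e > 0\<close> show ?thesis
      by (intro bexI[OF _ w(1)]) simp
  qed
  with W(1) show "\<exists>C. compact C \<and> (\<forall>u\<in>\<F>. \<exists>w\<in>C. dist u w < e)"
    using finite_imp_compact by blast
qed

lemma periodic_rmod:
  fixes f :: "real \<Rightarrow> 'a"
  assumes "\<And>t. f (t + \<omega>) = f t"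
  shows "f (t rmod \<omega>) = f t"
proof -
  interpret periodic_fun_simple f \<omega>
    by unfold_locales (rule assms)
  obtain n where "t = t rmod \<omega> + of_int n * \<omega>"
    using rcong_altdef[of "t rmod \<omega>" t \<omega>] by auto
  then show ?thesis
    using plus_of_int[of "t rmod \<omega>" n] by simp
qed

lemma rmod_in_period: "\<omega> > 0 \<Longrightarrow> t rmod \<omega> \<in> {0..\<omega>}"
  by (simp add: rmod_nonneg rmod_le)

lemma bounded_continuous_periodic:
  fixes f :: "real \<Rightarrow> 'a::metric_space"
  assumes "\<omega> > 0" "continuous_on UNIV f" and per: "\<And>t. f (t + \<omega>) = f t"
  shows "f \<in> bcontfun"
proof -
  have "f t \<in> f ` {0..\<omega>}" for t
    using periodic_rmod[of f, OF per, of t] rmod_in_period[OF assms(1)] by (metis imageI)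
  then have "range f \<subseteq> f ` {0..\<omega>}" by blast
  moreover have "compact (f ` {0..\<omega>})"
    using assms(2) continuous_on_subset by (intro compact_continuous_image) auto
  ultimately show ?thesis
    using assms(2) by (auto simp: bcontfun_def intro: bounded_subset compact_imp_bounded)
qed

definition periodic_functions :: "real \<Rightarrow> 'a::metric_space set \<Rightarrow> (real \<Rightarrow>\<^sub>C 'a) set" where
  "periodic_functions \<omega> K = {u :: real \<Rightarrow>\<^sub>C 'a. \<forall>t. u t \<in> K \<and> u (t + \<omega>) = u t}"

lemma periodic_functionsD:
  assumes "u \<in> periodic_functions \<omega> K"
  shows "u t \<in> K" "u (t + \<omega>) = u t"
  using assms by (auto simp: periodic_functions_def)

lemma closed_convex_cone_periodic_functions:
  fixes K :: "'a::real_normed_vector set"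
  assumes K: "closed_convex_cone K"
  shows "closed_convex_cone (periodic_functions \<omega> K)"
proof (rule closed_convex_coneI)
  have "closed ((\<lambda>u :: real \<Rightarrow>\<^sub>C 'a. u t) -` K)" for t
    by (intro closed_vimage closed_convex_coneD(1)[OF K] continuous_intros)
  then have "closed {u :: real \<Rightarrow>\<^sub>C 'a. u t \<in> K}" for t
    by (simp add: vimage_def)
  then show "closed (periodic_functions \<omega> K)"
    unfolding periodic_functions_def
    by (intro closed_Collect_all closed_Collect_conj closed_Collect_eq continuous_intros)
qed (auto simp: periodic_functions_def closed_convex_coneD[OF K])

lemma cone_le_periodic_functionsD:
  "cone_le (periodic_functions \<omega> K) u v \<Longrightarrow> cone_le K (u t) (v t)"
  by (simp add: cone_le_def periodic_functions_def)

lemma normal_cone_periodic_functions: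
  assumes "normal_cone K"
  shows "normal_cone (periodic_functions \<omega> K)"
proof -
  obtain N where N: "N > 0" "\<And>x y. cone_le K 0 x \<Longrightarrow> cone_le K x y \<Longrightarrow> norm x \<le> N * norm y"
    using assms by (auto simp: normal_cone_def)
  have "norm u \<le> N * norm v"
    if "cone_le (periodic_functions \<omega> K) 0 u" "cone_le (periodic_functions \<omega> K) u v" for u v
  proof (rule norm_bound)
    fix t
    have "norm (u t) \<le> N * norm (v t)"
      using cone_le_periodic_functionsD[OF that(1), of t] cone_le_periodic_functionsD[OF that(2), of t] N(2)
      by simp
    also have "\<dots> \<le> N * norm v"
      using N(1) norm_bounded by (simp add: mult_left_mono)
    finally show "norm (u t) \<le> N * norm v" .
  qed
  with N(1) show ?thesis by (auto simp: normal_cone_def)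
qed

definition delay :: "real \<Rightarrow> (real \<Rightarrow>\<^sub>C 'a::metric_space) \<Rightarrow> real \<Rightarrow>\<^sub>C 'a" where
  "delay \<tau> u = Bcontfun (\<lambda>t. u (t - \<tau>))"

lemma apply_delay [simp]: "delay \<tau> u t = u (t - \<tau>)"
proof -
  have "range (\<lambda>t. u (t - \<tau>)) \<subseteq> range (apply_bcontfun u)" by blast
  then have "(\<lambda>t. u (t - \<tau>)) \<in> bcontfun"
    by (auto simp: bcontfun_def intro!: continuous_intros intro: bounded_subset[OF bounded_apply_bcontfun])
  then show ?thesis by (simp add: delay_def Bcontfun_inverse)
qed

lemma delay_in_periodic_functions:
  assumes "u \<in> periodic_functions \<omega> K"
  shows "delay \<tau> u \<in> periodic_functions \<omega> K"
proof -
  have "u (t + \<omega> - \<tau>) = u (t - \<tau>)" for t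
    using periodic_functionsD(2)[OF assms, of "t - \<tau>"] by (simp add: algebra_simps)
  then show ?thesis
    using periodic_functionsD(1)[OF assms] by (simp add: periodic_functions_def)
qed

lemma bounded_linear_delay: "bounded_linear (delay \<tau> :: (real \<Rightarrow>\<^sub>C 'a::real_normed_vector) \<Rightarrow> _)"
proof (rule bounded_linear_intro[where K = 1])
  show "norm (delay \<tau> u) \<le> norm u * 1" for u :: "real \<Rightarrow>\<^sub>C 'a"
    by (rule norm_bound) (simp add: norm_bounded)
qed (auto intro: bcontfun_eqI)

section \<open>Exponentially stable semigroups\<close>

locale exponentially_stable_semigroup =
  fixes T :: "real \<Rightarrow> 'a::banach \<Rightarrow>\<^sub>L 'a" and M \<gamma> :: real
  assumes semigroup: "C0_semigroup T"
    and \<gamma>_pos: "\<gamma> > 0"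
    and norm_T_le_exp: "\<And>t. t \<ge> 0 \<Longrightarrow> norm (T t) \<le> M * exp (- \<gamma> * t)"
begin

lemma T_0: "T 0 x = x"
  using semigroup by (simp add: C0_semigroup_def)

lemma T_add: "s \<ge> 0 \<Longrightarrow> t \<ge> 0 \<Longrightarrow> T (s + t) x = T s (T t x)"
  using semigroup by (simp add: C0_semigroup_def)

lemma M_nonneg: "M \<ge> 0"
  using order_trans[OF norm_ge_zero norm_T_le_exp[of 0]] by simp

lemma norm_T_le: "t \<ge> 0 \<Longrightarrow> norm (T t) \<le> M"
  using norm_T_le_exp[of t] M_nonneg \<gamma>_pos mult_left_le[of "exp (- \<gamma> * t)" M] by simp

lemma norm_T_apply_le: "t \<ge> 0 \<Longrightarrow> norm (T t x) \<le> M * norm x"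
  using norm_blinfun[of "T t" x] mult_right_mono[OF norm_T_le[of t], of "norm x"] by simp

lemma continuous_on_T:
  fixes S :: "'c::topological_space set"
  assumes "continuous_on S t" "continuous_on S x" "\<And>s. s \<in> S \<Longrightarrow> t s \<ge> 0"
  shows "continuous_on S (\<lambda>s. T (t s) (x s))"
proof -
  have "continuous_on ({0..} \<times> UNIV) (\<lambda>(t, x). T t x)"
  proof (rule continuous_on_Pair_if_lipschitz)
    show "M-lipschitz_on UNIV (T t)" if "t \<in> {0..}" for t
      using that norm_T_apply_le[of t] M_nonneg
      by (auto intro!: lipschitz_onI simp: dist_norm simp flip: blinfun.diff_right)
    show "continuous_on {0..} (\<lambda>t. T t x)" for x
      using semigroup by (simp add: C0_semigroup_def)
  qed
  from continuous_on_compose2[OF this continuous_on_Pair[OF assms(1,2)]] assms(3) show ?thesis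
    by auto
qed

text \<open>\<open>decay_ball C\<close> is the closed ball of radius \<open>C\<close> in the equivalent norm \<open>sup\<^sub>r exp (\<gamma> r) \<parallel>T r x\<parallel>\<close>.\<close>

definition decay_ball :: "real \<Rightarrow> 'a set" where
  "decay_ball C = {x. \<forall>r\<ge>0. norm (T r x) \<le> C * exp (- \<gamma> * r)}"

lemma decay_ballD: "x \<in> decay_ball C \<Longrightarrow> r \<ge> 0 \<Longrightarrow> norm (T r x) \<le> C * exp (- \<gamma> * r)"
  by (simp add: decay_ball_def)

lemma norm_le_if_in_decay_ball: "x \<in> decay_ball C \<Longrightarrow> norm x \<le> C"
  using decay_ballD[of x C 0] by (simp add: T_0)

lemma in_decay_ball_if_norm_le:
  assumes "norm x \<le> B"
  shows "x \<in> decay_ball (M * B)"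
  unfolding decay_ball_def
proof (intro CollectI allI impI)
  fix r :: real assume "r \<ge> 0"
  have "norm (T r x) \<le> norm (T r) * norm x"
    by (rule norm_blinfun)
  also have "\<dots> \<le> (M * exp (- \<gamma> * r)) * B"
    using assms \<open>r \<ge> 0\<close> M_nonneg by (intro mult_mono norm_T_le_exp) auto
  finally show "norm (T r x) \<le> M * B * exp (- \<gamma> * r)"
    by (simp add: mult_ac)
qed

lemma decay_ball_add_scaleR:
  assumes x: "x \<in> decay_ball C" and y: "y \<in> decay_ball C" and "a \<ge> 0" "b \<ge> 0"
  shows "a *\<^sub>R x + b *\<^sub>R y \<in> decay_ball ((a + b) * C)"
  unfolding decay_ball_def
proof (intro CollectI allI impI)
  fix r :: real assume "r \<ge> 0"
  have "norm (T r (a *\<^sub>R x + b *\<^sub>R y)) \<le> a * norm (T r x) + b * norm (T r y)"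
    using norm_triangle_ineq[of "a *\<^sub>R T r x" "b *\<^sub>R T r y"] \<open>a \<ge> 0\<close> \<open>b \<ge> 0\<close>
    by (simp add: blinfun.add_right blinfun.scaleR_right)
  also have "\<dots> \<le> a * (C * exp (- \<gamma> * r)) + b * (C * exp (- \<gamma> * r))"
    using \<open>r \<ge> 0\<close> by (intro add_mono mult_left_mono decay_ballD x y assms(3,4))
  finally show "norm (T r (a *\<^sub>R x + b *\<^sub>R y)) \<le> (a + b) * C * exp (- \<gamma> * r)"
    by (simp add: algebra_simps)
qed

text \<open>\<open>duhamel b f t\<close> is the integral of \<open>T (t - s) (f s)\<close> over \<open>t - b \<le> s \<le> t\<close>, and the bounded mild
  solution of \<open>u' + A u = f\<close> is its limit as \<open>b\<close> tends to infinity.\<close>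

definition duhamel :: "real \<Rightarrow> (real \<Rightarrow>\<^sub>C 'a) \<Rightarrow> real \<Rightarrow>\<^sub>C 'a" where
  "duhamel b f = Bcontfun (\<lambda>t. integral {0..b} (\<lambda>r. T r (f (t - r))))"

definition mild_solution :: "(real \<Rightarrow>\<^sub>C 'a) \<Rightarrow> real \<Rightarrow>\<^sub>C 'a" where
  "mild_solution f = lim (\<lambda>n. duhamel (real n) f)"

lemma continuous_on_integrand:
  fixes f :: "real \<Rightarrow>\<^sub>C 'a"
  shows "S \<subseteq> {0..} \<Longrightarrow> continuous_on S (\<lambda>r. T r (f (t - r)))"
  by (intro continuous_on_T continuous_intros) auto

lemma integrable_integrand:
  fixes f :: "real \<Rightarrow>\<^sub>C 'a"
  shows "0 \<le> a \<Longrightarrow> (\<lambda>r. T r (f (t - r))) integrable_on {a..b}"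
  by (intro integrable_continuous_interval continuous_on_integrand) auto

lemma norm_integral_integrand_le:
  fixes f :: "real \<Rightarrow>\<^sub>C 'a"
  assumes "b \<ge> 0"
  shows "norm (integral {0..b} (\<lambda>r. T r (f (t - r)))) \<le> M * norm f * b"
proof -
  have "norm (T r (f (t - r))) \<le> M * norm f" if "r \<in> {0..b}" for r
    using that norm_T_apply_le[of r] norm_bounded[of f "t - r"] M_nonneg
    by (meson atLeastAtMost_iff mult_left_mono order_trans)
  from integral_bound[OF assms _ this] show ?thesis
    by (simp add: continuous_on_integrand)
qed

lemma apply_duhamel:
  assumes "b \<ge> 0"
  shows "duhamel b f t = integral {0..b} (\<lambda>r. T r (f (t - r)))"
proof -
  have "continuous_on (UNIV \<times> cbox 0 b) (\<lambda>(t, r). T r (f (t - r)))"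
    unfolding case_prod_unfold by (intro continuous_on_T continuous_intros) auto
  then have "continuous_on UNIV (\<lambda>t. integral (cbox 0 b) (\<lambda>r. T r (f (t - r))))"
    by (rule integral_continuous_on_param)
  then have "(\<lambda>t. integral {0..b} (\<lambda>r. T r (f (t - r)))) \<in> bcontfun"
    using norm_integral_integrand_le[OF assms] by (intro bcontfun_normI) auto
  then show ?thesis
    by (simp add: duhamel_def Bcontfun_inverse)
qed

lemma norm_apply_duhamel_le: "b \<ge> 0 \<Longrightarrow> norm (duhamel b f t) \<le> M * norm f * b"
  by (simp add: apply_duhamel norm_integral_integrand_le)

lemma duhamel_diff:
  assumes "0 \<le> a" "a \<le> b"
  shows "duhamel b f t - duhamel a f t = integral {a..b} (\<lambda>r. T r (f (t - r)))"
  using Henstock_Kurzweil_Integration.integral_combine[OF assms integrable_integrand[of 0 f t b]] assms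
  by (simp add: apply_duhamel algebra_simps)

lemma norm_duhamel_diff_le:
  fixes f :: "real \<Rightarrow>\<^sub>C 'a"
  assumes f: "\<And>s. f s \<in> decay_ball C" and "0 \<le> a" "a \<le> b"
  shows "norm (duhamel b f t - duhamel a f t) \<le> C / \<gamma> * exp (- \<gamma> * a)"
proof -
  have "((\<lambda>r. C * exp (- \<gamma> * r)) has_integral
      (- (C / \<gamma>) * exp (- \<gamma> * b) - (- (C / \<gamma>) * exp (- \<gamma> * a)))) {a..b}"
    using \<gamma>_pos \<open>a \<le> b\<close>
    by (intro fundamental_theorem_of_calculus)
      (auto intro!: derivative_eq_intros simp flip: has_real_derivative_iff_has_vector_derivative)
  then have exp_integral: "((\<lambda>r. C * exp (- \<gamma> * r)) has_integral
      (C / \<gamma> * exp (- \<gamma> * a) - C / \<gamma> * exp (- \<gamma> * b))) {a..b}"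
    by simp
  have "norm (integral {a..b} (\<lambda>r. T r (f (t - r)))) \<le> integral {a..b} (\<lambda>r. C * exp (- \<gamma> * r))"
    using \<open>0 \<le> a\<close>
    by (intro Henstock_Kurzweil_Integration.integral_norm_bound_integral integrable_integrand
        has_integral_integrable[OF exp_integral] decay_ballD f) auto
  also have "\<dots> = C / \<gamma> * exp (- \<gamma> * a) - C / \<gamma> * exp (- \<gamma> * b)"
    using exp_integral by (rule integral_unique)
  also have "\<dots> \<le> C / \<gamma> * exp (- \<gamma> * a)"
    using order_trans[OF norm_ge_zero norm_le_if_in_decay_ball[OF f]] \<gamma>_pos by simp
  finally show ?thesis
    by (simp add: duhamel_diff assms(2,3))
qed

lemma in_decay_ball_norm:
  fixes f :: "real \<Rightarrow>\<^sub>C 'a"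
  shows "f s \<in> decay_ball (M * norm f)"
  by (rule in_decay_ball_if_norm_le[OF norm_bounded])

lemma tendsto_exp_decay: "((\<lambda>t. C * exp (- \<gamma> * t)) \<longlongrightarrow> 0) at_top"
proof (intro tendsto_mult_right_zero filterlim_compose[OF exp_at_bot])
  show "filterlim (\<lambda>t. - \<gamma> * t) at_bot at_top"
    using \<gamma>_pos by (intro filterlim_tendsto_neg_mult_at_bot[OF tendsto_const _ filterlim_ident]) simp
qed

lemma duhamel_LIMSEQ: "(\<lambda>n. duhamel (real n) f) \<longlonglongrightarrow> mild_solution f"
proof -
  let ?C = "M * norm f / \<gamma>"
  have dist_le: "dist (duhamel (real m) f) (duhamel (real n) f) \<le> ?C * exp (- \<gamma> * real n)"
    if "n \<le> m" for m n
    using that norm_duhamel_diff_le[OF in_decay_ball_norm] by (intro dist_bound) (simp add: dist_norm)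
  have "Cauchy (\<lambda>n. duhamel (real n) f)"
  proof (rule metric_CauchyI)
    fix e :: real assume "e > 0"
    have "(\<lambda>n. ?C * exp (- \<gamma> * real n)) \<longlonglongrightarrow> 0"
      by (rule filterlim_compose[OF tendsto_exp_decay filterlim_real_sequentially])
    then have "\<forall>\<^sub>F n in sequentially. ?C * exp (- \<gamma> * real n) < e / 2"
      using \<open>e > 0\<close> by (intro order_tendstoD(2)) auto
    then obtain n where n: "?C * exp (- \<gamma> * real n) < e / 2"
      by (auto simp: eventually_sequentially)
    have "dist (duhamel (real m) f) (duhamel (real k) f) < e" if "n \<le> m" "n \<le> k" for m k
      by (rule dist_triangle_half_l[OF le_less_trans[OF dist_le n] le_less_trans[OF dist_le n]])
        (fact that)+
    then show "\<exists>n. \<forall>m\<ge>n. \<forall>k\<ge>n. dist (duhamel (real m) f) (duhamel (real k) f) < e" by blast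
  qed
  then show ?thesis
    unfolding mild_solution_def by (simp add: Cauchy_convergent_iff convergent_LIMSEQ_iff)
qed

lemma norm_mild_solution_minus_duhamel_le:
  fixes f :: "real \<Rightarrow>\<^sub>C 'a"
  assumes f: "\<And>s. f s \<in> decay_ball C" and "b \<ge> 0"
  shows "norm (mild_solution f t - duhamel b f t) \<le> C / \<gamma> * exp (- \<gamma> * b)"
proof (rule Lim_bounded)
  show "(\<lambda>n. norm (duhamel (real n) f t - duhamel b f t))
      \<longlonglongrightarrow> norm (mild_solution f t - duhamel b f t)"
    by (intro tendsto_intros
        tendsto_uniform_limitI[OF tendsto_bcontfun_uniform_limit[OF duhamel_LIMSEQ]]) simp
  show "\<forall>n\<ge>nat \<lceil>b\<rceil>. norm (duhamel (real n) f t - duhamel b f t)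
      \<le> C / \<gamma> * exp (- \<gamma> * b)"
    using norm_duhamel_diff_le[OF f \<open>b \<ge> 0\<close>] by (auto simp: nat_le_iff ceiling_le_iff)
qed

lemma duhamel_tendsto: "((\<lambda>b. duhamel b f t) \<longlongrightarrow> mild_solution f t) at_top"
proof (rule LIM_zero_cancel, rule Lim_null_comparison)
  show "((\<lambda>b. M * norm f / \<gamma> * exp (- \<gamma> * b)) \<longlongrightarrow> 0) at_top"
    by (rule tendsto_exp_decay)
  show "\<forall>\<^sub>F b in at_top. norm (duhamel b f t - mild_solution f t)
      \<le> M * norm f / \<gamma> * exp (- \<gamma> * b)"
    using eventually_ge_at_top[of 0]
    by eventually_elim (subst norm_minus_commute,
        rule norm_mild_solution_minus_duhamel_le[OF in_decay_ball_norm])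
qed

lemma T_duhamel:
  assumes "c \<ge> 0" "b \<ge> 0"
  shows "T c (duhamel b f t) = duhamel (c + b) f (t + c) - duhamel c f (t + c)"
proof -
  have "T c (duhamel b f t) = integral {0..b} (\<lambda>r. T c (T r (f (t - r))))"
    using integral_linear[OF integrable_integrand[of 0 f t b] blinfun.bounded_linear_right, of "T c"]
    by (simp add: apply_duhamel \<open>b \<ge> 0\<close> o_def)
  also have "\<dots> = integral {0..b} ((\<lambda>r. T r (f (t + c - r))) \<circ> (+) c)"
    using \<open>c \<ge> 0\<close> by (intro Henstock_Kurzweil_Integration.integral_cong) (simp add: T_add)
  also have "\<dots> = integral {c..c + b} (\<lambda>r. T r (f (t + c - r)))"
    by (subst integral_shift_Icc_real) (simp add: add.commute)
  finally show ?thesis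
    using assms by (simp add: duhamel_diff)
qed

lemma T_mild_solution:
  assumes "c \<ge> 0"
  shows "T c (mild_solution f t) = mild_solution f (t + c) - duhamel c f (t + c)"
proof (rule tendsto_unique[OF trivial_limit_at_top_linorder])
  show "((\<lambda>b. T c (duhamel b f t)) \<longlongrightarrow> T c (mild_solution f t)) at_top"
    by (intro tendsto_intros duhamel_tendsto)
  have "((\<lambda>b. duhamel (c + b) f (t + c)) \<longlongrightarrow> mild_solution f (t + c)) at_top"
    by (intro filterlim_compose[OF duhamel_tendsto]
        filterlim_tendsto_add_at_top[OF tendsto_const filterlim_ident])
  then have "((\<lambda>b. duhamel (c + b) f (t + c) - duhamel c f (t + c)) \<longlongrightarrow>
      mild_solution f (t + c) - duhamel c f (t + c)) at_top"
    by (intro tendsto_intros)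
  then show "((\<lambda>b. T c (duhamel b f t)) \<longlongrightarrow>
      mild_solution f (t + c) - duhamel c f (t + c)) at_top"
    by (rule Lim_transform_eventually)
      (use eventually_ge_at_top[of 0] in eventually_elim, simp add: T_duhamel \<open>c \<ge> 0\<close>)
qed

lemma has_integral_mild_solution:
  fixes f :: "real \<Rightarrow>\<^sub>C 'a"
  assumes "a \<le> t"
  shows "((\<lambda>s. T (t - s) (f s)) has_integral
    mild_solution f t - T (t - a) (mild_solution f a)) {a..t}"
proof -
  have "((\<lambda>r. T r (f (t - r))) has_integral duhamel (t - a) f t) (cbox 0 (t - a))"
    using assms integrable_integral[OF integrable_integrand[of 0 f t "t - a"]] by (simp add: apply_duhamel)
  from has_integral_affinity[OF this, of "-1" t]
  have "((\<lambda>s. T (t - s) (f s)) has_integral duhamel (t - a) f t) {a..t}"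
    using assms by (simp add: image_affinity_atLeastAtMost)
  then show ?thesis
    using T_mild_solution[of "t - a" f a] assms by simp
qed

lemma dist_mild_solution_le:
  assumes "a \<le> t" "norm f \<le> B"
  shows "dist (mild_solution f t) (T (t - a) (mild_solution f a)) \<le> M * B * (t - a)"
proof -
  have "dist (mild_solution f t) (T (t - a) (mild_solution f a)) \<le> M * norm f * (t - a)"
    using T_mild_solution[of "t - a" f a] norm_apply_duhamel_le[of "t - a" f t] assms(1)
    by (simp add: dist_norm)
  also have "\<dots> \<le> M * B * (t - a)"
    using assms M_nonneg by (intro mult_right_mono mult_left_mono) auto
  finally show ?thesis .
qed

lemma mild_solution_in_decay_ball:
  fixes f :: "real \<Rightarrow>\<^sub>C 'a"
  assumes "\<And>s. f s \<in> decay_ball C"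
  shows "mild_solution f t \<in> decay_ball (C / \<gamma>)"
  unfolding decay_ball_def
  using T_mild_solution[of _ f t] norm_mild_solution_minus_duhamel_le[OF assms] by simp

lemma bounded_linear_mild_solution: "bounded_linear mild_solution"
proof (rule bounded_linear_intro)
  have add: "duhamel b (f + g) = duhamel b f + duhamel b g"
    and scaleR: "duhamel b (c *\<^sub>R f) = c *\<^sub>R duhamel b f"
    if "b \<ge> 0" for b c f g
    using that by (auto intro!: bcontfun_eqI Henstock_Kurzweil_Integration.integral_add integrable_integrand
        simp: apply_duhamel blinfun.add_right blinfun.scaleR_right)
  show "mild_solution (f + g) = mild_solution f + mild_solution g" for f g
    using LIMSEQ_unique[OF duhamel_LIMSEQ] tendsto_add[OF duhamel_LIMSEQ duhamel_LIMSEQ, of f g]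
    by (simp add: add)
  show "mild_solution (c *\<^sub>R f) = c *\<^sub>R mild_solution f" for c f
    using LIMSEQ_unique[OF duhamel_LIMSEQ] tendsto_scaleR[OF tendsto_const duhamel_LIMSEQ, of c f]
    by (simp add: scaleR)
  show "norm (mild_solution f) \<le> norm f * (M / \<gamma>)" for f
    using norm_le_if_in_decay_ball[OF mild_solution_in_decay_ball[OF in_decay_ball_norm, of f]]
    by (intro norm_bound) (simp add: mult.commute)
qed

lemma mild_solution_in_periodic_functions:
  assumes K: "closed_convex_cone K" and pos: "positive_semigroup T K" and f: "f \<in> periodic_functions \<omega> K"
  shows "mild_solution f \<in> periodic_functions \<omega> K"
proof -
  have "T r (f s) \<in> K" if "r \<ge> 0" for r s
    using pos that periodic_functionsD(1)[OF f] by (auto simp: positive_semigroup_def)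
  then have "integral {0..b} (\<lambda>r. T r (f (t - r))) \<in> K" for b t
    by (intro has_integral_in_closed_convex_cone[OF K integrable_integral[OF integrable_integrand]]) auto
  moreover have "f (t + \<omega> - r) = f (t - r)" for t r
    using periodic_functionsD(2)[OF f, of "t - r"] by (simp add: algebra_simps)
  ultimately have "duhamel (real n) f \<in> periodic_functions \<omega> K" for n
    by (simp add: periodic_functions_def apply_duhamel)
  then show ?thesis
    using closed_convex_coneD(1)[OF closed_convex_cone_periodic_functions[OF K]]
    by (intro closed_sequentially[OF _ _ duhamel_LIMSEQ])
qed

lemma compact_closure_mild_solution_values:
  assumes cpt: "compact_semigroup T" and bdd: "bounded \<F>"
  shows "compact (closure {mild_solution f t |f t. f \<in> \<F>})"
proof (rule compact_closure_if_near_compact)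
  fix e :: real assume "e > 0"
  obtain B where B: "B > 0" "\<And>f. f \<in> \<F> \<Longrightarrow> norm f \<le> B"
    using bdd by (auto simp: bounded_pos)
  define \<delta> where "\<delta> = e / (M * B + 1)"
  have \<delta>: "\<delta> > 0" "M * B * \<delta> < e"
    using \<open>e > 0\<close> B(1) M_nonneg by (auto simp: \<delta>_def field_simps add_pos_nonneg)
  let ?C = "closure (T \<delta> ` (\<lambda>(f, t). mild_solution f t) ` (\<F> \<times> UNIV))"
  have "norm (mild_solution f t) \<le> M * B / \<gamma>" if "f \<in> \<F>" for f t
    by (rule norm_le_if_in_decay_ball[OF mild_solution_in_decay_ball[OF in_decay_ball_if_norm_le]])
      (rule order_trans[OF norm_bounded B(2)[OF that]])
  then have "bounded ((\<lambda>(f, t). mild_solution f t) ` (\<F> \<times> UNIV))"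
    by (auto simp: bounded_iff)
  then have "compact ?C"
    using cpt \<delta>(1) by (simp add: compact_semigroup_def compact_operator_def)
  moreover have "\<exists>y\<in>?C. dist (mild_solution f t) y < e" if f: "f \<in> \<F>" for f t
  proof
    let ?y = "T \<delta> (mild_solution f (t - \<delta>))"
    show "?y \<in> ?C"
      using f by (intro subsetD[OF closure_subset]) force
    show "dist (mild_solution f t) ?y < e"
      using dist_mild_solution_le[OF _ B(2)[OF f], of "t - \<delta>" t] \<delta> by simp
  qed
  ultimately show "\<exists>C. compact C \<and> (\<forall>x\<in>{mild_solution f t |f t. f \<in> \<F>}. \<exists>y\<in>C. dist x y < e)"
    by blast
qed

lemma uniformly_strongly_continuous_on_compact:
  assumes "compact C" "e > 0"
  obtains d where "d > 0" "\<And>r x. 0 \<le> r \<Longrightarrow> r < d \<Longrightarrow> x \<in> C \<Longrightarrow> dist (T r x) x < e"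
proof -
  have "uniformly_continuous_on ({0..1} \<times> C) (\<lambda>p. T (fst p) (snd p))"
    by (intro compact_uniformly_continuous continuous_on_T continuous_intros
        compact_Times compact_Icc assms) auto
  then obtain d where d: "d > 0"
    "\<And>p p'. p \<in> {0..1} \<times> C \<Longrightarrow> p' \<in> {0..1} \<times> C \<Longrightarrow> dist p' p < d \<Longrightarrow>
      dist (T (fst p') (snd p')) (T (fst p) (snd p)) < e"
    using \<open>e > 0\<close> unfolding uniformly_continuous_on_def by meson
  show ?thesis
  proof (rule that[of "min 1 d"])
    show "dist (T r x) x < e" if "0 \<le> r" "r < min 1 d" "x \<in> C" for r x
      using d(2)[of "(0, x)" "(r, x)"] that by (simp add: dist_Pair_Pair T_0)
  qed (use d(1) in simp)
qed

lemma equicontinuous_mild_solution: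
  assumes cpt: "compact_semigroup T" and bdd: "bounded \<F>" and "e > 0"
  obtains d where "d > 0"
    "\<And>f s t. f \<in> \<F> \<Longrightarrow> \<bar>s - t\<bar> < d \<Longrightarrow> dist (mild_solution f s) (mild_solution f t) < e"
proof -
  obtain B where B: "B > 0" "\<And>f. f \<in> \<F> \<Longrightarrow> norm f \<le> B"
    using bdd by (auto simp: bounded_pos)
  obtain d where d: "d > 0" "\<And>r x. 0 \<le> r \<Longrightarrow> r < d \<Longrightarrow>
      x \<in> closure {mild_solution f t |f t. f \<in> \<F>} \<Longrightarrow> dist (T r x) x < e / 2"
    using uniformly_strongly_continuous_on_compact[OF compact_closure_mild_solution_values[OF cpt bdd]
        half_gt_zero[OF \<open>e > 0\<close>]] by blast
  have MB_pos: "M * B + 1 > 0" using B(1) M_nonneg by (simp add: add_nonneg_pos)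
  define d' where "d' = min d (e / 2 / (M * B + 1))"
  have "d' > 0" using d(1) \<open>e > 0\<close> MB_pos by (simp add: d'_def)
  have forward: "dist (mild_solution f s) (mild_solution f t) < e"
    if f: "f \<in> \<F>" and "s \<le> t" "t - s < d'" for f s t
  proof -
    have "dist (mild_solution f t) (T (t - s) (mild_solution f s)) \<le> M * B * (t - s)"
      using dist_mild_solution_le[OF \<open>s \<le> t\<close> B(2)[OF f]] .
    also have "\<dots> \<le> (M * B + 1) * (t - s)"
      using \<open>s \<le> t\<close> by (intro mult_right_mono) auto
    also have "\<dots> \<le> e / 2"
      using pos_le_divide_eq[OF MB_pos, of "t - s" "e / 2"] that by (simp add: d'_def mult.commute)
    finally have "dist (T (t - s) (mild_solution f s)) (mild_solution f t) \<le> e / 2"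
      by (simp add: dist_commute)
    moreover have "dist (T (t - s) (mild_solution f s)) (mild_solution f s) < e / 2"
      using that by (intro d(2) subsetD[OF closure_subset]) (auto simp: d'_def)
    ultimately show ?thesis
      using dist_triangle3[of "mild_solution f s" "mild_solution f t"
          "T (t - s) (mild_solution f s)"]
      by linarith
  qed
  show ?thesis
  proof (rule that[OF \<open>d' > 0\<close>])
    show "dist (mild_solution f s) (mild_solution f t) < e" if "f \<in> \<F>" "\<bar>s - t\<bar> < d'" for f s t
      using forward[of f s t] forward[of f t s] that by (cases "s \<le> t") (auto simp: dist_commute)
  qed
qed

lemma compact_closure_mild_solution_image:
  assumes cpt: "compact_semigroup T" and bdd: "bounded \<F>"
    and "\<omega> > 0" and periodic: "mild_solution ` \<F> \<subseteq> periodic_functions \<omega> UNIV"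
  shows "compact (closure (mild_solution ` \<F>))"
proof (rule compact_closure_bcontfun)
  show "compact (closure ((\<lambda>u. apply_bcontfun u t) ` mild_solution ` \<F>))" for t
    by (rule compact_closure_subset[OF _ compact_closure_mild_solution_values[OF cpt bdd]]) blast
  fix e :: real assume "e > 0"
  then obtain d where d: "d > 0"
    "\<And>f s t. f \<in> \<F> \<Longrightarrow> \<bar>s - t\<bar> < d \<Longrightarrow> dist (mild_solution f s) (mild_solution f t) < e"
    using equicontinuous_mild_solution[OF cpt bdd] by metis
  obtain G where G: "finite G" "{0..\<omega>} \<subseteq> (\<Union>g\<in>G. ball g d)"
    using compact_Icc[of 0 \<omega>] d(1) unfolding compact_eq_totally_bounded by meson
  have "\<exists>g\<in>G. \<forall>u\<in>mild_solution ` \<F>. dist (u t) (u g) < e" for t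
  proof -
    obtain g where g: "g \<in> G" "\<bar>t rmod \<omega> - g\<bar> < d"
      using G(2) rmod_in_period[OF \<open>\<omega> > 0\<close>, of t] by (force simp: dist_real_def)
    have "u (t rmod \<omega>) = u t" if "u \<in> mild_solution ` \<F>" for u
      using that periodic by (intro periodic_rmod periodic_functionsD(2)) blast
    with g d(2) show ?thesis by (intro bexI[of _ g]) force+
  qed
  with G(1) show "\<exists>G. finite G \<and> (\<forall>t. \<exists>g\<in>G. \<forall>u\<in>mild_solution ` \<F>. dist (u t) (u g) < e)"
    by blast
qed

definition delay_feedback :: "real \<Rightarrow> real \<Rightarrow> real \<Rightarrow> (real \<Rightarrow>\<^sub>C 'a) \<Rightarrow> real \<Rightarrow>\<^sub>C 'a" where
  "delay_feedback c1 c2 \<tau> u = mild_solution (c1 *\<^sub>R u + c2 *\<^sub>R delay \<tau> u)"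

lemma bounded_linear_delay_feedback: "bounded_linear (delay_feedback c1 c2 \<tau>)"
  unfolding delay_feedback_def
  by (intro bounded_linear_compose[OF bounded_linear_mild_solution] bounded_linear_add
      bounded_linear_const_scaleR bounded_linear_delay bounded_linear_ident)

lemma delay_feedback_power_in_decay_ball:
  fixes u :: "real \<Rightarrow>\<^sub>C 'a"
  assumes "c1 \<ge> 0" "c2 \<ge> 0" and u: "\<And>s. u s \<in> decay_ball C"
  shows "(delay_feedback c1 c2 \<tau> ^^ n) u t \<in> decay_ball (((c1 + c2) / \<gamma>) ^ n * C)"
proof (induction n arbitrary: t)
  case (Suc n)
  let ?w = "(delay_feedback c1 c2 \<tau> ^^ n) u"
  have "(c1 *\<^sub>R ?w + c2 *\<^sub>R delay \<tau> ?w) s \<in> decay_ball ((c1 + c2) * (((c1 + c2) / \<gamma>) ^ n * C))" for s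
    using decay_ball_add_scaleR[OF Suc Suc assms(1,2)] by simp
  from mild_solution_in_decay_ball[OF this] show ?case
    by (simp add: delay_feedback_def[of c1 c2 \<tau> ?w] mult.assoc)
qed (simp add: u)

lemma summable_delay_feedback_powers:
  assumes "c1 \<ge> 0" "c2 \<ge> 0" "c1 + c2 < \<gamma>"
  shows "summable (\<lambda>n. (delay_feedback c1 c2 \<tau> ^^ n) u)"
proof (rule summable_comparison_test')
  show "summable (\<lambda>n. ((c1 + c2) / \<gamma>) ^ n * (M * norm u))"
    using assms \<gamma>_pos by (intro summable_mult2 summable_geometric) simp
  show "norm ((delay_feedback c1 c2 \<tau> ^^ n) u) \<le> ((c1 + c2) / \<gamma>) ^ n * (M * norm u)" if "n \<ge> 0" for n
    by (intro norm_bound norm_le_if_in_decay_ball delay_feedback_power_in_decay_ball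
        in_decay_ball_norm assms(1,2))
qed

lemma linear_delay_equation_solution:
  assumes X: "closed_convex_cone X" and c: "c1 \<ge> 0" "c2 \<ge> 0" "c1 + c2 < \<gamma>"
    and mild_X: "\<And>u. u \<in> X \<Longrightarrow> mild_solution u \<in> X" and delay_X: "\<And>u. u \<in> X \<Longrightarrow> delay \<tau> u \<in> X"
    and h: "h \<in> X"
  obtains v where "v \<in> X" "v = mild_solution (c1 *\<^sub>R v + c2 *\<^sub>R delay \<tau> v + h)"
proof -
  define V where "V n = (delay_feedback c1 c2 \<tau> ^^ n) (mild_solution h)" for n
  have summable: "summable V"
    unfolding V_def using c by (rule summable_delay_feedback_powers)
  define v where "v = suminf V"
  have "v = V 0 + (\<Sum>n. V (Suc n))"
    unfolding v_def using suminf_split_head[OF summable] by simp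
  also have "(\<Sum>n. V (Suc n)) = delay_feedback c1 c2 \<tau> v"
    unfolding v_def bounded_linear.suminf[OF bounded_linear_delay_feedback summable] by (simp add: V_def)
  also have "V 0 + delay_feedback c1 c2 \<tau> v = mild_solution (c1 *\<^sub>R v + c2 *\<^sub>R delay \<tau> v + h)"
    by (simp add: V_def delay_feedback_def linear_simps(1)[OF bounded_linear_mild_solution])
  finally have "v = mild_solution (c1 *\<^sub>R v + c2 *\<^sub>R delay \<tau> v + h)" .
  moreover have "V n \<in> X" for n
    unfolding V_def
    by (induction n) (auto simp: delay_feedback_def intro!: mild_X delay_X closed_convex_coneD[OF X] h c)
  then have "v \<in> X"
    unfolding v_def using X summable by (intro suminf_in_closed_convex_cone)
  ultimately show ?thesis using that by blast
qed

end

section \<open>The nonlinear delay equation\<close>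

locale periodic_delay_nonlinearity =
  fixes K :: "'a::real_normed_vector set" and F :: "real \<Rightarrow> 'a \<Rightarrow> 'a \<Rightarrow> 'a" and \<tau> \<omega> :: real
  assumes \<omega>_pos: "\<omega> > 0"
    and F_in_K: "\<And>t x y. x \<in> K \<Longrightarrow> y \<in> K \<Longrightarrow> F t x y \<in> K"
    and F_continuous: "continuous_on (UNIV \<times> K \<times> K) (\<lambda>(t, x, y). F t x y)"
    and F_periodic: "\<And>t x y. x \<in> K \<Longrightarrow> y \<in> K \<Longrightarrow> F (t + \<omega>) x y = F t x y"
begin

abbreviation periodic_cone :: "(real \<Rightarrow>\<^sub>C 'a) set" where
  "periodic_cone \<equiv> periodic_functions \<omega> K"

definition superposition :: "(real \<Rightarrow>\<^sub>C 'a) \<Rightarrow> real \<Rightarrow>\<^sub>C 'a" where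
  "superposition u = Bcontfun (\<lambda>t. F t (u t) (u (t - \<tau>)))"

lemma continuous_on_F_apply:
  "continuous_on (periodic_cone \<times> UNIV) (\<lambda>(u, t). F t (u t) (u (t - \<tau>)))"
proof -
  let ?arguments = "\<lambda>(u :: real \<Rightarrow>\<^sub>C 'a, t). (t, u t, u (t - \<tau>))"
  have "continuous_on (periodic_cone \<times> UNIV) ?arguments"
    unfolding case_prod_unfold by (intro continuous_intros)
  moreover have "?arguments ` (periodic_cone \<times> UNIV) \<subseteq> UNIV \<times> K \<times> K"
    by (auto dest: periodic_functionsD(1))
  ultimately show ?thesis
    using continuous_on_compose2[OF F_continuous] by (fastforce simp: case_prod_unfold)
qed

lemma F_apply_periodic:
  assumes u: "u \<in> periodic_cone"
  shows "F (t + \<omega>) (u (t + \<omega>)) (u (t + \<omega> - \<tau>)) = F t (u t) (u (t - \<tau>))"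
  using F_periodic[OF periodic_functionsD(1)[OF u] periodic_functionsD(1)[OF u]]
    periodic_functionsD(2)[OF u, of t] periodic_functionsD(2)[OF delay_in_periodic_functions[OF u], of \<tau> t]
  by simp

lemma apply_superposition:
  assumes u: "u \<in> periodic_cone"
  shows "superposition u t = F t (u t) (u (t - \<tau>))"
proof -
  have "continuous_on UNIV (\<lambda>t. F t (u t) (u (t - \<tau>)))"
    using continuous_on_compose2[OF continuous_on_F_apply, of UNIV "\<lambda>t. (u, t)"] u
    by (simp add: image_subset_iff continuous_on_Pair)
  then have "(\<lambda>t. F t (u t) (u (t - \<tau>))) \<in> bcontfun"
    using \<omega>_pos F_apply_periodic[OF u] by (intro bounded_continuous_periodic)
  then show ?thesis
    by (simp add: superposition_def Bcontfun_inverse)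
qed

lemma superposition_in_periodic_cone:
  assumes u: "u \<in> periodic_cone"
  shows "superposition u \<in> periodic_cone"
  unfolding periodic_functions_def
  by (simp add: apply_superposition[OF u] F_apply_periodic[OF u] F_in_K periodic_functionsD(1)[OF u])

lemma continuous_on_superposition: "continuous_on periodic_cone superposition"
  unfolding continuous_on_iff
proof (intro ballI allI impI)
  fix u :: "real \<Rightarrow>\<^sub>C 'a" and e :: real assume u: "u \<in> periodic_cone" and "e > 0"
  have "continuous_on (periodic_cone \<times> {0..\<omega>}) (\<lambda>(u, t). F t (u t) (u (t - \<tau>)))"
    by (rule continuous_on_subset[OF continuous_on_F_apply]) auto
  from continuous_on_prod_compactE[OF this compact_Icc u half_gt_zero[OF \<open>e > 0\<close>]]
  obtain N where N: "u \<in> N" "open N" and near_on_period: "\<forall>w\<in>N \<inter> periodic_cone. \<forall>t\<in>{0..\<omega>}.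
      dist (F t (w t) (w (t - \<tau>))) (F t (u t) (u (t - \<tau>))) \<le> e / 2"
    by auto
  obtain d where d: "d > 0" "ball u d \<subseteq> N"
    using N openE by blast
  have "dist (superposition w) (superposition u) < e"
    if w: "w \<in> periodic_cone" and "dist w u < d" for w
  proof -
    have "dist (superposition w t) (superposition u t) \<le> e / 2" for t
    proof -
      have periodic: "superposition u (t rmod \<omega>) = superposition u t"
        if "u \<in> periodic_cone" for u
        by (rule periodic_rmod) (rule periodic_functionsD(2)[OF superposition_in_periodic_cone[OF that]])
      have "w \<in> N \<inter> periodic_cone"
        using w \<open>dist w u < d\<close> d(2) by (auto simp: dist_commute)
      with near_on_period rmod_in_period[OF \<omega>_pos, of t]
      have "dist (superposition w (t rmod \<omega>)) (superposition u (t rmod \<omega>)) \<le> e / 2"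
        unfolding apply_superposition[OF u] apply_superposition[OF w] by blast
      then show ?thesis by (simp only: periodic u w)
    qed
    then have "dist (superposition w) (superposition u) \<le> e / 2" by (rule dist_bound)
    with \<open>e > 0\<close> show ?thesis by simp
  qed
  with d(1) show "\<exists>d>0. \<forall>w\<in>periodic_cone. dist w u < d \<longrightarrow> dist (superposition w) (superposition u) < e"
    by blast
qed

lemma superposition_le_on_cone_interval:
  fixes h :: "real \<Rightarrow>\<^sub>C 'a"
  assumes K: "closed_convex_cone K" and c: "c1 \<ge> 0" "c2 \<ge> 0"
    and growth: "\<And>t x y. x \<in> K \<Longrightarrow> y \<in> K \<Longrightarrow> cone_le K (F t x y) (c1 *\<^sub>R x + c2 *\<^sub>R y + h t)"
    and h: "h \<in> periodic_cone"
    and u: "u \<in> cone_interval periodic_cone 0 v"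
  shows "cone_le periodic_cone (superposition u) (c1 *\<^sub>R v + c2 *\<^sub>R delay \<tau> v + h)"
proof -
  have u_in_cone: "u \<in> periodic_cone" and diff_in_cone: "v - u \<in> periodic_cone"
    using u by (simp_all add: cone_interval_def cone_le_def)
  let ?bound = "\<lambda>w. c1 *\<^sub>R w + c2 *\<^sub>R delay \<tau> w"
  have "?bound u + h - superposition u \<in> periodic_cone"
    unfolding periodic_functions_def
  proof (intro CollectI allI conjI)
    fix t
    show "(?bound u + h - superposition u) t \<in> K"
      using growth[OF periodic_functionsD(1)[OF u_in_cone] periodic_functionsD(1)[OF u_in_cone]]
      by (simp add: cone_le_def apply_superposition[OF u_in_cone])
    show "(?bound u + h - superposition u) (t + \<omega>) = (?bound u + h - superposition u) t"
      using periodic_functionsD(2)[OF u_in_cone] periodic_functionsD(2)[OF h]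
        periodic_functionsD(2)[OF delay_in_periodic_functions[OF u_in_cone]]
        periodic_functionsD(2)[OF superposition_in_periodic_cone[OF u_in_cone]]
      by (simp del: apply_delay)
  qed
  moreover have "?bound (v - u) \<in> periodic_cone"
    by (intro closed_convex_coneD[OF closed_convex_cone_periodic_functions[OF K]]
        delay_in_periodic_functions diff_in_cone c)
  moreover have "?bound v + h - superposition u = (?bound u + h - superposition u) + ?bound (v - u)"
    by (simp add: linear_simps(2)[OF bounded_linear_delay] algebra_simps)
  ultimately show ?thesis
    using closed_convex_coneD(4)[OF closed_convex_cone_periodic_functions[OF K]] by (metis cone_le_def)
qed

end

lemma exponential_bound_if_growth_bound_less:
  assumes "growth_bound T < ereal (- c)"
  obtains M \<gamma> where "c < \<gamma>" "\<And>t. t \<ge> 0 \<Longrightarrow> norm (T t) \<le> M * exp (- \<gamma> * t)"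
proof -
  obtain \<gamma> M where "\<gamma> < - c" "\<forall>t\<ge>0. norm (T t) \<le> M * exp (\<gamma> * t)"
    using assms unfolding growth_bound_def Inf_less_iff by auto
  then show ?thesis
    using that[of "- \<gamma>" M] by simp
qed

locale semilinear_delay_equation =
  exponentially_stable_semigroup T M \<gamma> + periodic_delay_nonlinearity K F \<tau> \<omega>
  for T :: "real \<Rightarrow> 'a::banach \<Rightarrow>\<^sub>L 'a" and M \<gamma> :: real
    and K :: "'a set" and F :: "real \<Rightarrow> 'a \<Rightarrow> 'a \<Rightarrow> 'a" and \<tau> \<omega> :: real +
  assumes K_cone: "closed_convex_cone K" and K_normal: "normal_cone K"
    and T_positive: "positive_semigroup T K" and T_compact: "compact_semigroup T"
begin

lemmas closed_convex_cone_periodic_cone = closed_convex_cone_periodic_functions[OF K_cone, of \<omega>]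
  and mild_solution_in_periodic_cone = mild_solution_in_periodic_functions[OF K_cone T_positive, of _ \<omega>]

lemma mild_solution_mono:
  assumes "cone_le periodic_cone f g"
  shows "cone_le periodic_cone (mild_solution f) (mild_solution g)"
  using mild_solution_in_periodic_cone[of "g - f"] assms
  by (simp add: cone_le_def linear_simps(2)[OF bounded_linear_mild_solution])

lemma fixpoint_if_supersolution:
  assumes v: "v \<in> periodic_cone" "cone_le periodic_cone (mild_solution g) v"
    and le_g: "\<And>u. u \<in> cone_interval periodic_cone 0 v \<Longrightarrow> cone_le periodic_cone (superposition u) g"
  obtains u where "u \<in> periodic_cone" "mild_solution (superposition u) = u"
proof -
  let ?I = "cone_interval periodic_cone 0 v" and ?Q = "\<lambda>u. mild_solution (superposition u)"
  have I_subset: "?I \<subseteq> periodic_cone" by (auto simp: cone_interval_def cone_le_def)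
  have "?Q u \<in> ?I" if "u \<in> ?I" for u
  proof -
    have "?Q u \<in> periodic_cone"
      using that I_subset by (intro mild_solution_in_periodic_cone superposition_in_periodic_cone) blast
    moreover have "cone_le periodic_cone (?Q u) v"
      using mild_solution_mono[OF le_g[OF that]] v(2)
        closed_convex_coneD(4)[OF closed_convex_cone_periodic_cone]
      by (force simp: cone_le_def)
    ultimately show ?thesis by (simp add: cone_interval_def cone_le_def)
  qed
  then have maps: "?Q \<in> ?I \<rightarrow> ?I" by blast
  have "superposition ` ?I \<subseteq> cone_interval periodic_cone 0 g"
    using superposition_in_periodic_cone I_subset le_g by (auto simp: cone_interval_def cone_le_def)
  then have bdd: "bounded (superposition ` ?I)"
    by (rule bounded_subset[OF bounded_cone_interval[OF normal_cone_periodic_functions[OF K_normal]]])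
  have "mild_solution ` superposition ` ?I \<subseteq> periodic_functions \<omega> UNIV"
    using maps I_subset by (force simp: periodic_functions_def)
  from compact_closure_mild_solution_image[OF T_compact bdd \<omega>_pos this]
  have "compact (closure (?Q ` ?I))"
    by (simp add: image_image)
  moreover have "continuous_on ?I ?Q"
    by (intro bounded_linear.continuous_on[OF bounded_linear_mild_solution]
        continuous_on_subset[OF continuous_on_superposition I_subset])
  moreover have "0 \<in> ?I"
    using v(1) closed_convex_coneD(3)[OF closed_convex_cone_periodic_cone]
    by (simp add: cone_interval_def cone_le_def)
  ultimately obtain u where "u \<in> ?I" "?Q u = u"
    using schauder_fixpoint[of ?I ?Q] maps closed_cone_interval convex_cone_interval
      closed_convex_coneD(1,2)[OF closed_convex_cone_periodic_cone] by blast
  with I_subset that show ?thesis by blast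
qed

lemma fixpoint_if_linear_growth:
  fixes h :: "real \<Rightarrow>\<^sub>C 'a"
  assumes c: "c1 \<ge> 0" "c2 \<ge> 0" "c1 + c2 < \<gamma>"
    and growth: "\<And>t x y. x \<in> K \<Longrightarrow> y \<in> K \<Longrightarrow> cone_le K (F t x y) (c1 *\<^sub>R x + c2 *\<^sub>R y + h t)"
    and h: "h \<in> periodic_cone"
  obtains u where "u \<in> periodic_cone" "mild_solution (superposition u) = u"
proof -
  obtain v where v: "v \<in> periodic_cone" "v = mild_solution (c1 *\<^sub>R v + c2 *\<^sub>R delay \<tau> v + h)"
    using linear_delay_equation_solution[OF closed_convex_cone_periodic_cone c
        mild_solution_in_periodic_cone delay_in_periodic_functions h] .
  moreover have "cone_le periodic_cone (superposition u) (c1 *\<^sub>R v + c2 *\<^sub>R delay \<tau> v + h)"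
    if "u \<in> cone_interval periodic_cone 0 v" for u
    using superposition_le_on_cone_interval[OF K_cone c(1,2) growth h that] .
  moreover have "cone_le periodic_cone (mild_solution (c1 *\<^sub>R v + c2 *\<^sub>R delay \<tau> v + h)) v"
    using v(2) closed_convex_coneD(3)[OF closed_convex_cone_periodic_cone] by (simp add: cone_le_def)
  ultimately show ?thesis
    using fixpoint_if_supersolution that by blast
qed

lemma positive_periodic_mild_solution_if_fixpoint:
  assumes u: "u \<in> periodic_cone" "mild_solution (superposition u) = u"
  shows "positive_periodic_mild_solution T K F \<tau> \<omega> u"
  using has_integral_mild_solution[of _ _ "superposition u"] periodic_functionsD[OF u(1)]
  by (simp add: positive_periodic_mild_solution_def u(2) apply_superposition[OF u(1)])

end

theorem theorem1p1:
  fixes K :: "'a::banach set"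
    and A :: "'a \<Rightarrow> 'a" and D :: "'a set"
    and T :: "real \<Rightarrow> 'a \<Rightarrow>\<^sub>L 'a"
    and F :: "real \<Rightarrow> 'a \<Rightarrow> 'a \<Rightarrow> 'a"
    and h0 :: "real \<Rightarrow> 'a"
    and \<tau> \<omega> C1 C2 :: real
  assumes cone: "closed_convex_cone K" and normal: "normal_cone K"
    and Aop: "closed_linear_operator A D"
    and semigroup: "C0_semigroup T"
    and gen: "is_generator T (\<lambda>x. - A x) D"
    and pos: "positive_semigroup T K"
    and cpt: "compact_semigroup T"
    and stable: "growth_bound T < 0"
    and tau: "\<tau> > 0" and omega: "\<omega> > 0"
    and F_K: "\<And>t x y. x \<in> K \<Longrightarrow> y \<in> K \<Longrightarrow> F t x y \<in> K"
    and F_cont: "continuous_on (UNIV \<times> K \<times> K) (\<lambda>(t, x, y). F t x y)"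
    and F_per: "\<And>t x y. x \<in> K \<Longrightarrow> y \<in> K \<Longrightarrow> F (t + \<omega>) x y = F t x y"
    and C1: "C1 > 0" and C2: "C2 > 0"
    and C12: "ereal (C1 + C2) < - growth_bound T"
    and h0_cont: "continuous_on UNIV h0"
    and h0_per: "\<And>t. h0 (t + \<omega>) = h0 t"
    and h0_K: "\<And>t. h0 t \<in> K"
    and H1: "\<And>t x y. x \<in> K \<Longrightarrow> y \<in> K \<Longrightarrow>
               cone_le K (F t x y) (C1 *\<^sub>R x + C2 *\<^sub>R y + h0 t)"
  shows "\<exists>u. positive_periodic_mild_solution T K F \<tau> \<omega> u"
proof -
  have "growth_bound T < ereal (- (C1 + C2))"
    using C12 by (simp add: ereal_less_uminus_reorder)
  then obtain M \<gamma> where \<gamma>: "C1 + C2 < \<gamma>" and T_bound: "\<And>t. t \<ge> 0 \<Longrightarrow> norm (T t) \<le> M * exp (- \<gamma> * t)"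
    using exponential_bound_if_growth_bound_less by blast
  interpret semilinear_delay_equation T M \<gamma> K F \<tau> \<omega>
    using C1 C2 \<gamma> T_bound cone normal semigroup pos cpt omega F_K F_cont F_per by unfold_locales auto
  obtain h where h: "h0 = apply_bcontfun h"
    using bounded_continuous_periodic[OF omega h0_cont h0_per] by (rule bcontfunE)
  have "h \<in> periodic_cone"
    using h0_K h0_per by (simp add: periodic_functions_def h)
  then obtain u where "u \<in> periodic_cone" "mild_solution (superposition u) = u"
    using fixpoint_if_linear_growth[OF less_imp_le[OF C1] less_imp_le[OF C2] \<gamma>] H1[unfolded h] by blast
  then show ?thesis
    using positive_periodic_mild_solution_if_fixpoint by blast
qed

end
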